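(* Let $\mathcal{T}\subset\mathcal{K}$ be a database of $n$ objects and let $q\in\mathcal{K}$ be a query point. Assume the rank disorder $D$ of $\mathcal{T}\cup\{q\}$ is known. Then there exists a (randomized) data structure on $\mathcal{T}$ with the following properties. Building it requires asking $O(nD^3\log^2 n\,\log\log (n^{D^3}))$ oracle questions in total, and it stores $O(n\log^2 n/\log(2D))$ bits in total. Using it, the nearest neighbor of $q$ in $\mathcal{T}$ is retrieved with high probability by asking $O(D^3\log^2 n\,\log\log (n^{D^3}))$ oracle questions.
   Context: Setting: a hidden space $\mathcal{K}$ with a distance function $d(\cdot,\cdot)$, which need not be a metric; all distances are assumed pairwise distinct. The database is $\mathcal{T}\subset\mathcal{K}$ with $|\mathcal{T}|=n$. The space can only be accessed through a similarity oracle. For $q\in\mathcal{K}$ and $u,v\in\mathcal{T}$, the oracle $O(q,u,v)$ returns $u$ if $d(u,q)\le d(v,q)$ and returns $v$ otherwise. Each oracle call counts as one "question". Ranks: for a set $S$ and objects $u,v$, the rank $r_v(u,S)=c$ if $u$ is the $c$-th nearest object to $v$ in $S$; in particular $r_x(x,S)=0$. Rank disorder: the rank disorder of a set $S$ is the smallest $D$ such that for all $x,y,z\in S$: (1) $r_x(y,S)\le D(r_z(x,S)+r_z(y,S))$; (2) $r_x(y,S)\le D(r_x(z,S)+r_y(z,S))$; (3) $r_x(y,S)\le D(r_x(z,S)+r_z(y,S))$; (4) $r_x(y,S)\le D(r_z(x,S)+r_y(z,S))$. "With high probability" means with probability at least $1-1/n$. *)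

theory Defs
  imports "HOL-Probability.Probability"
begin

text \<open>
  \<open>d u x\<close> is the distance from \<open>u\<close> to the reference object \<open>x\<close>; \<open>d\<close> is not assumed to be
  symmetric or to satisfy a triangle inequality. Distinctness is stated for unordered pairs of
  different objects, so that symmetric \<open>d\<close> are admitted. The first conjunct (an object is nearest
  to itself) is what the convention \<open>r\<^sub>x(x,S) = 0\<close> expresses.
\<close>

definition hidden_space :: "'a set \<Rightarrow> ('a \<Rightarrow> 'a \<Rightarrow> real) \<Rightarrow> bool" where
  "hidden_space K d \<longleftrightarrow>
     (\<forall>x\<in>K. \<forall>y\<in>K. y \<noteq> x \<longrightarrow> d x x < d y x) \<and>
     (\<forall>x\<in>K. \<forall>y\<in>K. \<forall>x'\<in>K. \<forall>y'\<in>K.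
        x \<noteq> y \<and> x' \<noteq> y' \<and> d x y = d x' y' \<longrightarrow> {x, y} = {x', y'})"

definition similarity_oracle :: "('a \<Rightarrow> 'a \<Rightarrow> real) \<Rightarrow> 'a \<Rightarrow> 'a \<Rightarrow> 'a \<Rightarrow> 'a" where
  "similarity_oracle d q u v = (if d u q \<le> d v q then u else v)"

definition nearest_neighbor :: "('a \<Rightarrow> 'a \<Rightarrow> real) \<Rightarrow> 'a set \<Rightarrow> 'a \<Rightarrow> 'a \<Rightarrow> bool" where
  "nearest_neighbor d T q u \<longleftrightarrow> u \<in> T \<and> (\<forall>v\<in>T. d u q \<le> d v q)"

text \<open>
  \<open>obj_rank d S v u\<close> is \<open>r\<^sub>v(u,S)\<close>. The object \<open>v\<close> itself is not counted, so the nearest other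
  object has rank 1.
\<close>

definition obj_rank :: "('a \<Rightarrow> 'a \<Rightarrow> real) \<Rightarrow> 'a set \<Rightarrow> 'a \<Rightarrow> 'a \<Rightarrow> nat" where
  "obj_rank d S v u = card {w \<in> S - {v}. d w v \<le> d u v}"

definition disorder_inequalities :: "('a \<Rightarrow> 'a \<Rightarrow> real) \<Rightarrow> 'a set \<Rightarrow> real \<Rightarrow> bool" where
  "disorder_inequalities d S D \<longleftrightarrow>
     (\<forall>x\<in>S. \<forall>y\<in>S. \<forall>z\<in>S.
        real (obj_rank d S x y) \<le> D * (real (obj_rank d S z x) + real (obj_rank d S z y)) \<and>
        real (obj_rank d S x y) \<le> D * (real (obj_rank d S x z) + real (obj_rank d S y z)) \<and>
        real (obj_rank d S x y) \<le> D * (real (obj_rank d S x z) + real (obj_rank d S z y)) \<and>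
        real (obj_rank d S x y) \<le> D * (real (obj_rank d S z x) + real (obj_rank d S y z)))"

text \<open>
  The constraint \<open>0 \<le> D\<close> only matters when \<open>S\<close> has at most one element; otherwise the
  inequalities with \<open>z = x\<close> force \<open>1 \<le> D\<close>.
\<close>

definition rank_disorder :: "('a \<Rightarrow> 'a \<Rightarrow> real) \<Rightarrow> 'a set \<Rightarrow> real" where
  "rank_disorder d S = (LEAST D. 0 \<le> D \<and> disorder_inequalities d S D)"

text \<open>
  Adaptive algorithms that see the space only through the oracle. Database objects are accessed
  through names, which are natural numbers; \<open>Ask x u v k\<close> asks \<open>O(x,u,v)\<close> and
  continues with \<open>k\<close> applied to the name of the returned object. A randomized algorithm is a
  probability distribution on such trees.
\<close>

datatype ('x, 'r) dtree =
    Answer 'r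
  | Ask 'x nat nat "nat \<Rightarrow> ('x, 'r) dtree"

primrec outcome :: "('x \<Rightarrow> nat \<Rightarrow> nat \<Rightarrow> nat) \<Rightarrow> ('x, 'r) dtree \<Rightarrow> 'r" where
  "outcome orc (Answer r) = r"
| "outcome orc (Ask x u v k) = outcome orc (k (orc x u v))"

primrec asked :: "('x \<Rightarrow> nat \<Rightarrow> nat \<Rightarrow> nat) \<Rightarrow> ('x, 'r) dtree \<Rightarrow> ('x \<times> nat \<times> nat) list" where
  "asked orc (Answer r) = []"
| "asked orc (Ask x u v k) = (x, u, v) # asked orc (k (orc x u v))"

text \<open>
  The reference object of a question is a database object while the structure is being built
  (the query point is not yet available), and a database object or the query point during search.
\<close>

datatype ref = Query | Stored nat

primrec ref_object :: "(nat \<Rightarrow> 'a) \<Rightarrow> 'a \<Rightarrow> ref \<Rightarrow> 'a" where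
  "ref_object obj q Query = q"
| "ref_object obj q (Stored i) = obj i"

definition build_oracle :: "('a \<Rightarrow> 'a \<Rightarrow> real) \<Rightarrow> (nat \<Rightarrow> 'a) \<Rightarrow> nat \<Rightarrow> nat \<Rightarrow> nat \<Rightarrow> nat" where
  "build_oracle d obj x u v = (if similarity_oracle d (obj x) (obj u) (obj v) = obj u then u else v)"

definition search_oracle ::
  "('a \<Rightarrow> 'a \<Rightarrow> real) \<Rightarrow> (nat \<Rightarrow> 'a) \<Rightarrow> 'a \<Rightarrow> ref \<Rightarrow> nat \<Rightarrow> nat \<Rightarrow> nat" where
  "search_oracle d obj q x u v =
     (if similarity_oracle d (ref_object obj q x) (obj u) (obj v) = obj u then u else v)"

end

theory Submission
  imports Defs "HOL-Library.Log_Nat"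
begin

text \<open>
  Let \<open>E = \<lceil>D\<rceil>\<close> and \<open>L \<approx> 12 ln n\<close>. Take a hierarchy of random samples of \<open>T\<close>: level \<open>j\<close> contains
  each object independently with probability \<open>(17 E)\<^sup>-\<^sup>j\<close>, so level \<open>0\<close> is all of \<open>T\<close>; above these
  levels sits a single entry point. With \<open>\<rho>\<^sub>j = L (17 E)\<^sup>j\<close>, about \<open>c L\<close> samples of level \<open>j\<close> have rank
  at most \<open>c \<rho>\<^sub>j\<close> with respect to a given point. So with high probability every point has a level-\<open>j\<close>
  sample of rank at most \<open>\<rho>\<^sub>j\<close>, at most \<open>7 E L\<close> samples of rank at most \<open>2 E \<rho>\<^sub>j\<close>, and at least
  \<open>7 E L\<close> samples of rank at most \<open>17 E \<rho>\<^sub>j\<close>. Hence the beam of \<open>x\<close>, its \<open>7 E L\<close> nearest samples,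
  lies between the balls of radius \<open>2 E \<rho>\<^sub>j\<close> and \<open>17 E \<rho>\<^sub>j\<close>.

  Each object of level \<open>j\<close> stores only a pointer to its nearest sample in level \<open>j + 1\<close>, its parent.
  A sample \<open>y\<close> of level \<open>j\<close> with \<open>r\<^sub>x(y) \<le> 17 E \<rho>\<^sub>j = \<rho>\<^sub>j\<^sub>+\<^sub>1\<close> has a parent of rank at most
  \<open>E (\<rho>\<^sub>j\<^sub>+\<^sub>1 + \<rho>\<^sub>j\<^sub>+\<^sub>1)\<close> about \<open>x\<close>, that is, in the beam; so the next beam can be selected among the
  children of the current one. Conversely these children have rank at most
  \<open>E (17 E \<rho>\<^sub>j\<^sub>+\<^sub>1 + E \<rho>\<^sub>j\<^sub>+\<^sub>1) = 306 E\<^sup>3 \<rho>\<^sub>j\<close>, so there are only \<open>O(E\<^sup>3 L)\<close> of them, and merge sort finds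
  the new beam with \<open>O(D\<^sup>3 log n log (D\<^sup>3 log n))\<close> questions. The beam of the query in level \<open>0\<close>
  starts with its nearest neighbor. The parents themselves are found during construction by running the
  same search for every database object.
\<close>

section \<open>Decision trees\<close>

primrec bind_dtree :: "('x, 'r) dtree \<Rightarrow> ('r \<Rightarrow> ('x, 's) dtree) \<Rightarrow> ('x, 's) dtree" where
  "bind_dtree (Answer r) f = f r"
| "bind_dtree (Ask x u v k) f = Ask x u v (\<lambda>w. bind_dtree (k w) f)"

lemma outcome_bind_dtree [simp]:
  "outcome orc (bind_dtree t f) = outcome orc (f (outcome orc t))"
  by (induction t) auto

lemma asked_bind_dtree [simp]:
  "asked orc (bind_dtree t f) = asked orc t @ asked orc (f (outcome orc t))"
  by (induction t) auto

primrec traverse_dtree :: "('b \<Rightarrow> ('x, 'c) dtree) \<Rightarrow> 'b list \<Rightarrow> ('x, 'c list) dtree" where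
  "traverse_dtree f [] = Answer []"
| "traverse_dtree f (b # bs) =
     bind_dtree (f b) (\<lambda>c. bind_dtree (traverse_dtree f bs) (\<lambda>cs. Answer (c # cs)))"

lemma outcome_traverse_dtree [simp]:
  "outcome orc (traverse_dtree f bs) = map (\<lambda>b. outcome orc (f b)) bs"
  by (induction bs) auto

lemma asked_traverse_dtree [simp]:
  "asked orc (traverse_dtree f bs) = concat (map (\<lambda>b. asked orc (f b)) bs)"
  by (induction bs) auto

section \<open>Merge sort\<close>

fun merge_dtree :: "'x \<Rightarrow> nat list \<Rightarrow> nat list \<Rightarrow> ('x, nat list) dtree" where
  "merge_dtree x [] vs = Answer vs"
| "merge_dtree x us [] = Answer us"
| "merge_dtree x (u # us) (v # vs) = Ask x u v (\<lambda>w.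
     if w = u then bind_dtree (merge_dtree x us (v # vs)) (\<lambda>ws. Answer (u # ws))
     else bind_dtree (merge_dtree x (u # us) vs) (\<lambda>ws. Answer (v # ws)))"

fun mergesort_dtree :: "'x \<Rightarrow> nat list \<Rightarrow> ('x, nat list) dtree" where
  "mergesort_dtree x us = (if length us \<le> 1 then Answer us
     else bind_dtree (mergesort_dtree x (take (length us div 2) us)) (\<lambda>vs.
          bind_dtree (mergesort_dtree x (drop (length us div 2) us)) (merge_dtree x vs)))"

declare mergesort_dtree.simps [simp del]

definition selects_min :: "(nat \<Rightarrow> nat \<Rightarrow> nat) \<Rightarrow> (nat \<Rightarrow> 'k::linorder) \<Rightarrow> bool" where
  "selects_min select key \<longleftrightarrow> (\<forall>u v. select u v = (if key u \<le> key v then u else v))"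

lemma selects_min_build_oracle: "selects_min (build_oracle d obj x) (\<lambda>y. d (obj y) (obj x))"
  by (auto simp: selects_min_def build_oracle_def similarity_oracle_def)

lemma selects_min_search_oracle:
  "selects_min (search_oracle d obj q x) (\<lambda>y. d (obj y) (ref_object obj q x))"
  by (auto simp: selects_min_def search_oracle_def similarity_oracle_def)

lemma mset_outcome_merge_dtree [simp]:
  "mset (outcome orc (merge_dtree x us vs)) = mset us + mset vs"
  by (induction x us vs rule: merge_dtree.induct) auto

lemma set_outcome_merge_dtree [simp]:
  "set (outcome orc (merge_dtree x us vs)) = set us \<union> set vs"
  using mset_outcome_merge_dtree[of orc x us vs] by (metis set_mset_mset set_mset_union)

lemma sorted_outcome_merge_dtree:
  assumes "selects_min (orc x) key" "sorted (map key us)" "sorted (map key vs)"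
  shows "sorted (map key (outcome orc (merge_dtree x us vs)))"
  using assms
proof (induction x us vs rule: merge_dtree.induct)
  case (3 x u us v vs)
  show ?case
  proof (cases "key u \<le> key v")
    case True
    then have "orc x u v = u"
      using "3.prems"(1) by (simp add: selects_min_def)
    moreover have "\<forall>w \<in> set us \<union> set (v # vs). key u \<le> key w"
      using True "3.prems" by auto
    ultimately show ?thesis
      using "3.IH"(1)[of u] "3.prems" by simp
  next
    case False
    then have "orc x u v = v" "v \<noteq> u"
      using "3.prems"(1) by (auto simp: selects_min_def)
    moreover have "\<forall>w \<in> set (u # us) \<union> set vs. key v \<le> key w"
      using False "3.prems" by auto
    ultimately show ?thesis
      using "3.IH"(2)[of v] "3.prems" by simp
  qed
qed auto

lemma length_asked_merge_dtree:
  "length (asked orc (merge_dtree x us vs)) \<le> length us + length vs"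
  by (induction x us vs rule: merge_dtree.induct) auto

lemma set_asked_merge_dtree:
  assumes "set us \<subseteq> A" "set vs \<subseteq> A"
  shows "set (asked orc (merge_dtree x us vs)) \<subseteq> {x} \<times> A \<times> A"
  using assms
proof (induction x us vs rule: merge_dtree.induct)
  case (3 x u us v vs)
  then show ?case
    by (cases "orc x u v = u") simp_all
qed simp_all

lemma mergesort_dtree_short:
  assumes "length us \<le> 1"
  shows "mergesort_dtree x us = Answer us"
  using assms by (subst mergesort_dtree.simps) simp

lemma mergesort_dtree_long:
  assumes "\<not> length us \<le> 1"
  shows "mergesort_dtree x us =
    bind_dtree (mergesort_dtree x (take (length us div 2) us)) (\<lambda>vs.
      bind_dtree (mergesort_dtree x (drop (length us div 2) us)) (merge_dtree x vs))"
  using assms by (subst mergesort_dtree.simps) simp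

lemma mset_outcome_mergesort_dtree [simp]: "mset (outcome orc (mergesort_dtree x us)) = mset us"
proof (induction x us rule: mergesort_dtree.induct)
  case (1 x us)
  show ?case
  proof (cases "length us \<le> 1")
    case False
    have "mset (take (length us div 2) us) + mset (drop (length us div 2) us) = mset us"
      by (metis append_take_drop_id mset_append)
    with False 1 show ?thesis
      by (simp add: mergesort_dtree_long)
  qed (simp add: mergesort_dtree_short)
qed

lemma sorted_outcome_mergesort_dtree:
  assumes "selects_min (orc x) key"
  shows "sorted (map key (outcome orc (mergesort_dtree x us)))"
  using assms
proof (induction x us rule: mergesort_dtree.induct)
  case (1 x us)
  show ?case
  proof (cases "length us \<le> 1")
    case True
    then show ?thesis
      by (auto simp: mergesort_dtree_short le_Suc_eq length_Suc_conv)
  next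
    case False
    with 1 show ?thesis
      by (simp add: mergesort_dtree_long sorted_outcome_merge_dtree)
  qed
qed

lemma set_asked_mergesort_dtree:
  "set (asked orc (mergesort_dtree x us)) \<subseteq> {x} \<times> set us \<times> set us"
proof (induction x us rule: mergesort_dtree.induct)
  case (1 x us)
  show ?case
  proof (cases "length us \<le> 1")
    case False
    let ?l = "length us div 2"
    have halves: "set (take ?l us) \<subseteq> set us" "set (drop ?l us) \<subseteq> set us"
      by (rule set_take_subset set_drop_subset)+
    moreover have "set (outcome orc (mergesort_dtree x vs)) = set vs" for vs
      by (metis mset_outcome_mergesort_dtree set_mset_mset)
    ultimately have "set (asked orc (merge_dtree x (outcome orc (mergesort_dtree x (take ?l us)))
        (outcome orc (mergesort_dtree x (drop ?l us))))) \<subseteq> {x} \<times> set us \<times> set us"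
      by (intro set_asked_merge_dtree) simp_all
    then show ?thesis
      using "1.IH"[OF False] halves by (simp add: mergesort_dtree_long[OF False]) blast
  qed (simp add: mergesort_dtree_short)
qed

lemma length_asked_mergesort_dtree:
  assumes "length us \<le> 2 ^ k"
  shows "length (asked orc (mergesort_dtree x us)) \<le> k * length us"
  using assms
proof (induction k arbitrary: us)
  case 0
  then show ?case
    by (simp add: mergesort_dtree_short)
next
  case (Suc k)
  show ?case
  proof (cases "length us \<le> 1")
    case False
    let ?front = "take (length us div 2) us" and ?back = "drop (length us div 2) us"
    have halves: "length ?front \<le> 2 ^ k" "length ?back \<le> 2 ^ k"
      "length ?front + length ?back = length us"
      using Suc.prems by auto
    have "length (asked orc (merge_dtree x (outcome orc (mergesort_dtree x ?front))
        (outcome orc (mergesort_dtree x ?back)))) \<le> length us"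
      using length_asked_merge_dtree halves(3) by (metis mset_outcome_mergesort_dtree size_mset)
    then have "length (asked orc (mergesort_dtree x us))
        \<le> k * length ?front + (k * length ?back + length us)"
      using Suc.IH[OF halves(1)] Suc.IH[OF halves(2)] by (simp add: mergesort_dtree_long[OF False])
    also have "\<dots> = Suc k * length us"
      using halves(3) by (metis add.assoc add.commute distrib_left mult_Suc)
    finally show ?thesis .
  qed (simp add: mergesort_dtree_short)
qed

lemma filter_le_sorted_eq_take:
  fixes f :: "'b \<Rightarrow> 'k::linorder"
  assumes "sorted (map f ys)"
  shows "filter (\<lambda>y. f y \<le> t) ys = take (length (filter (\<lambda>y. f y \<le> t) ys)) ys"
  using assms
proof (induction ys)
  case (Cons y ys)
  show ?case
  proof (cases "f y \<le> t")
    case False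
    then have "filter (\<lambda>y. f y \<le> t) ys = []"
      using Cons.prems by (force simp: filter_empty_conv)
    with False show ?thesis by simp
  qed (use Cons in simp)
qed simp

lemma sorted_take_superset:
  fixes f :: "'b \<Rightarrow> 'k::linorder"
  assumes "sorted (map f ys)" "distinct ys" "card {y \<in> set ys. f y \<le> t} \<le> k"
  shows "{y \<in> set ys. f y \<le> t} \<subseteq> set (take k ys)"
proof -
  have "length (filter (\<lambda>y. f y \<le> t) ys) \<le> k"
    using assms(2,3) by (simp flip: distinct_card)
  then show ?thesis
    using filter_le_sorted_eq_take[OF assms(1), of t] set_take_subset_set_take by (metis set_filter)
qed

lemma sorted_take_subset:
  fixes f :: "'b \<Rightarrow> 'k::linorder"
  assumes "sorted (map f ys)" "distinct ys" "k \<le> card {y \<in> set ys. f y \<le> t}"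
  shows "set (take k ys) \<subseteq> {y \<in> set ys. f y \<le> t}"
proof -
  have "k \<le> length (filter (\<lambda>y. f y \<le> t) ys)"
    using assms(2,3) by (simp flip: distinct_card)
  then show ?thesis
    using filter_le_sorted_eq_take[OF assms(1), of t] set_take_subset_set_take by (metis set_filter)
qed

section \<open>Ranks\<close>

locale ranked_set =
  fixes d :: "'a \<Rightarrow> 'a \<Rightarrow> real" and S :: "'a set"
  assumes finite_S: "finite S"
    and self_nearest: "\<And>x y. x \<in> S \<Longrightarrow> y \<in> S \<Longrightarrow> y \<noteq> x \<Longrightarrow> d x x < d y x"
    and dist_inject: "\<And>x y z. x \<in> S \<Longrightarrow> y \<in> S \<Longrightarrow> z \<in> S \<Longrightarrow> d y x = d z x \<Longrightarrow> y = z"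
begin

abbreviation rank :: "'a \<Rightarrow> 'a \<Rightarrow> nat" where
  "rank \<equiv> obj_rank d S"

lemma rank_mono:
  assumes "d y x \<le> d z x"
  shows "rank x y \<le> rank x z"
  unfolding obj_rank_def using assms finite_S by (intro card_mono) auto

lemma rank_strict_mono:
  assumes "x \<in> S" "y \<in> S" "z \<in> S" "d y x < d z x"
  shows "rank x y < rank x z"
  unfolding obj_rank_def
proof (intro psubset_card_mono psubsetI)
  have "z \<noteq> x"
    using self_nearest[of x y] assms by (cases "y = x") auto
  then have "z \<in> {w \<in> S - {x}. d w x \<le> d z x} - {w \<in> S - {x}. d w x \<le> d y x}"
    using assms by simp
  then show "{w \<in> S - {x}. d w x \<le> d y x} \<noteq> {w \<in> S - {x}. d w x \<le> d z x}"
    by blast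
qed (use assms(4) finite_S in auto)

lemma inj_on_rank:
  assumes "x \<in> S"
  shows "inj_on (rank x) S"
proof (rule inj_onI)
  fix y z assume yz: "y \<in> S" "z \<in> S" "rank x y = rank x z"
  then have "d y x = d z x"
    using rank_strict_mono[OF assms, of y z] rank_strict_mono[OF assms, of z y] by fastforce
  then show "y = z"
    using dist_inject assms yz by blast
qed

lemma rank_less_card:
  assumes "x \<in> S"
  shows "rank x y < card S"
proof -
  have "rank x y \<le> card (S - {x})"
    unfolding obj_rank_def using finite_S by (intro card_mono) auto
  also have "\<dots> < card S"
    using assms finite_S by (intro psubset_card_mono) auto
  finally show ?thesis .
qed

lemma rank_image:
  assumes "x \<in> S"
  shows "rank x ` S = {..<card S}"
proof (rule card_subset_eq)
  show "rank x ` S \<subseteq> {..<card S}"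
    using rank_less_card assms by auto
  show "card (rank x ` S) = card {..<card S}"
    using inj_on_rank[OF assms] by (simp add: card_image)
qed simp

lemma card_rank_le:
  assumes "x \<in> S"
  shows "card {y \<in> S. rank x y \<le> k} = min (Suc k) (card S)"
proof -
  have "rank x ` {y \<in> S. rank x y \<le> k} = rank x ` S \<inter> {..k}"
    by auto
  also have "\<dots> = {..<min (Suc k) (card S)}"
    by (auto simp: rank_image[OF assms])
  finally have "rank x ` {y \<in> S. rank x y \<le> k} = {..<min (Suc k) (card S)}" .
  moreover have "inj_on (rank x) {y \<in> S. rank x y \<le> k}"
    using inj_on_rank[OF assms] by (rule inj_on_subset) auto
  ultimately show ?thesis
    by (metis card_image card_lessThan)
qed

lemma rank_self [simp]:
  assumes "x \<in> S"
  shows "rank x x = 0"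
proof -
  have "{w \<in> S - {x}. d w x \<le> d x x} = {}"
    using self_nearest[of x] assms by force
  then show ?thesis
    by (simp only: obj_rank_def card.empty)
qed

lemma rank_eq_0_iff:
  assumes "x \<in> S" "y \<in> S"
  shows "rank x y = 0 \<longleftrightarrow> y = x"
  using inj_on_rank[OF assms(1)] rank_self[OF assms(1)] assms by (metis inj_onD)

lemma disorder_inequalities_card: "disorder_inequalities d S (real (card S))"
proof -
  have rank_bound: "real (rank x y) \<le> real (card S) * (real a + real b)"
    if "x \<in> S" "y \<in> S" "a = 0 \<Longrightarrow> b = 0 \<Longrightarrow> y = x" for x y and a b :: nat
  proof (cases "a + b = 0")
    case True
    with that show ?thesis by auto
  next
    case False
    then have "real (card S) * 1 \<le> real (card S) * (real a + real b)"
      by (intro mult_left_mono) auto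
    then show ?thesis
      using rank_less_card[of x y] that(1) by linarith
  qed
  show ?thesis
    unfolding disorder_inequalities_def
    by (intro ballI conjI) (metis rank_bound rank_eq_0_iff)+
qed

lemma rank_disorder_least:
  shows "disorder_inequalities d S (rank_disorder d S)"
    and "rank_disorder d S \<le> real (card S)"
proof -
  define V where "V = {D. 0 \<le> D \<and> disorder_inequalities d S D}"
  have "closed V"
    unfolding V_def disorder_inequalities_def Collect_ball_eq Collect_conj_eq
    by (intro closed_Int closed_INT ballI closed_Collect_le continuous_intros)
  moreover have card_V: "real (card S) \<in> V"
    using disorder_inequalities_card by (simp add: V_def)
  moreover have bdd: "bdd_below V"
    by (rule bdd_belowI[of _ 0]) (simp add: V_def)
  ultimately have Inf_V: "Inf V \<in> V"
    by (intro closed_contains_Inf) auto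
  moreover have Inf_le: "Inf V \<le> D" if "D \<in> V" for D
    using that bdd by (rule cInf_lower)
  ultimately have "rank_disorder d S = Inf V"
    unfolding rank_disorder_def by (intro Least_equality) (auto simp: V_def)
  then show "disorder_inequalities d S (rank_disorder d S)" "rank_disorder d S \<le> real (card S)"
    using Inf_V Inf_le[OF card_V] by (auto simp: V_def)
qed

lemma disorder_inequalities_ge_1:
  assumes "disorder_inequalities d S D" "x \<in> S" "y \<in> S" "x \<noteq> y"
  shows "1 \<le> D"
proof -
  have "real (rank x y) \<le> D * (real (rank x x) + real (rank x y))"
    using assms(1)[unfolded disorder_inequalities_def, rule_format, OF assms(2,3,2)] by blast
  moreover have "rank x y > 0"
    using rank_eq_0_iff[of x y] assms by auto
  ultimately show ?thesis
    using assms by simp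
qed

end

lemma disorder_inequalities_mono:
  assumes "disorder_inequalities d S D" "D \<le> D'"
  shows "disorder_inequalities d S D'"
proof -
  have le: "D * (real b + real c) \<le> D' * (real b + real c)" for b c
    using assms(2) by (intro mult_right_mono) auto
  show ?thesis
    using assms(1) unfolding disorder_inequalities_def
    by (intro ballI conjI; intro order_trans[OF _ le]) simp_all
qed

lemma ranked_set_hidden_space:
  assumes "hidden_space K d" "finite S" "S \<subseteq> K"
  shows "ranked_set d S"
proof
  have self: "d x x < d y x" if "x \<in> S" "y \<in> S" "y \<noteq> x" for x y
    using assms(1,3) that unfolding hidden_space_def by (simp add: subset_iff)
  then show "\<And>x y. x \<in> S \<Longrightarrow> y \<in> S \<Longrightarrow> y \<noteq> x \<Longrightarrow> d x x < d y x" .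
  fix x y z assume xyz: "x \<in> S" "y \<in> S" "z \<in> S" and dist_eq: "d y x = d z x"
  show "y = z"
  proof (cases "y = x \<or> z = x")
    case True
    then show ?thesis
      using self[of x y] self[of x z] xyz dist_eq by force
  next
    case False
    then have "{y, x} = {z, x}"
      using assms(1) dist_eq xyz[THEN subsetD[OF assms(3)]] unfolding hidden_space_def by meson
    with False show ?thesis by auto
  qed
qed fact

section \<open>Tails of the binomial distribution\<close>

lemma expectation_exp_binomial_pmf:
  fixes s :: real
  assumes "p \<in> {0..1}"
  shows "measure_pmf.expectation (binomial_pmf m p) (\<lambda>k. exp (s * real k)) =
    (1 + p * (exp s - 1)) ^ m"
proof -
  have "measure_pmf.expectation (binomial_pmf m p) (\<lambda>k. exp (s * real k)) =
      (\<Sum>k\<le>m. real (m choose k) * p ^ k * (1 - p) ^ (m - k) * exp s ^ k)"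
    using assms by (simp add: expectation_binomial_pmf' exp_of_nat2_mult mult.commute)
  also have "\<dots> = (\<Sum>k\<le>m. real (m choose k) * (p * exp s) ^ k * (1 - p) ^ (m - k))"
    by (simp add: power_mult_distrib mult_ac)
  also have "\<dots> = (p * exp s + (1 - p)) ^ m"
    by (rule binomial_ring[symmetric])
  finally show ?thesis
    by (simp add: algebra_simps)
qed

lemma binomial_pmf_Chernoff:
  fixes s :: real
  assumes "p \<in> {0..1}"
  shows "measure_pmf.prob (binomial_pmf m p) {k. a \<le> s * real k}
    \<le> exp (p * real m * (exp s - 1) - a)"
proof -
  let ?M = "binomial_pmf m p"
  have "measure_pmf.prob ?M {k. a \<le> s * real k} =
      measure_pmf.prob ?M {k \<in> space ?M. exp a \<le> exp (s * real k)}"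
    by simp
  also have "\<dots> \<le> measure_pmf.expectation ?M (\<lambda>k. exp (s * real k)) / exp a"
    using assms by (intro integral_Markov_inequality_measure[where A = UNIV]) auto
  also have "\<dots> = (1 + p * (exp s - 1)) ^ m / exp a"
    by (simp add: expectation_exp_binomial_pmf[OF assms])
  also have "\<dots> \<le> exp (p * (exp s - 1)) ^ m / exp a"
  proof (intro divide_right_mono power_mono)
    have "0 \<le> (1 - p) + p * exp s"
      using assms by simp
    then show "0 \<le> 1 + p * (exp s - 1)"
      by (simp add: algebra_simps)
  qed auto
  also have "\<dots> = exp (p * real m * (exp s - 1) - a)"
    by (simp add: exp_diff exp_of_nat_mult[symmetric] mult_ac)
  finally show ?thesis .
qed

lemma binomial_pmf_upper_tail:
  assumes "p \<in> {0..1}" "p * real m \<le> \<mu>"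
  shows "measure_pmf.prob (binomial_pmf m p) {k. a \<le> real k} \<le> exp (2 * \<mu> - a)"
proof -
  have "p * real m * (exp 1 - 1) \<le> p * real m * 2"
    using exp_le assms(1) by (intro mult_left_mono) auto
  then have "exp (p * real m * (exp 1 - 1) - a) \<le> exp (2 * \<mu> - a)"
    using assms(2) by simp
  then show ?thesis
    using binomial_pmf_Chernoff[OF assms(1), of m a 1] by (auto intro: order_trans)
qed

lemma binomial_pmf_lower_tail:
  assumes "p \<in> {0..1}" "\<mu> \<le> p * real m"
  shows "measure_pmf.prob (binomial_pmf m p) {k. real k \<le> a} \<le> exp (a - \<mu> / 2)"
proof -
  have "exp (- 1 :: real) \<le> 1 / 2"
    using exp_ge_add_one_self[of 1] by (simp add: exp_minus inverse_eq_divide divide_le_eq)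
  then have "p * real m * (exp (- 1) - 1) \<le> p * real m * (- 1 / 2)"
    using assms(1) by (intro mult_left_mono) auto
  then have "exp (p * real m * (exp (- 1) - 1) - (- a)) \<le> exp (a - \<mu> / 2)"
    using assms(2) by simp
  then show ?thesis
    using binomial_pmf_Chernoff[OF assms(1), of m "- a" "- 1"] by (auto intro: order_trans)
qed

section \<open>Random subsets\<close>

definition random_subset :: "real \<Rightarrow> 'b set \<Rightarrow> 'b set pmf" where
  "random_subset p A = map_pmf (\<lambda>\<omega>. {a \<in> A. \<omega> a}) (Pi_pmf A False (\<lambda>_. bernoulli_pmf p))"

lemma random_subset_1:
  assumes "finite A"
  shows "random_subset 1 A = return_pmf A"
proof -
  have "bernoulli_pmf 1 = return_pmf True"
    by (rule pmf_eqI) (auto simp: pmf_return split: split_indicator)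
  with assms show ?thesis
    by (simp add: random_subset_def)
qed

lemma map_pmf_card_random_subset:
  assumes "finite A" "B \<subseteq> A" "p \<in> {0..1}"
  shows "map_pmf (\<lambda>M. card (M \<inter> B)) (random_subset p A) = binomial_pmf (card B) p"
proof -
  have "binomial_pmf (card B) p =
      map_pmf (\<lambda>\<omega>. card {b \<in> B. \<omega> b}) (Pi_pmf B False (\<lambda>_. bernoulli_pmf p))"
    using assms finite_subset by (intro binomial_pmf_altdef') auto
  also have "\<dots> = map_pmf (\<lambda>\<omega>. card ({a \<in> A. \<omega> a} \<inter> B)) (Pi_pmf A False (\<lambda>_. bernoulli_pmf p))"
    unfolding Pi_pmf_subset[OF assms(1,2)] pmf.map_comp
    using assms(2) by (intro map_pmf_cong refl) (auto intro!: arg_cong[where f = card])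
  finally show ?thesis
    by (simp add: random_subset_def pmf.map_comp comp_def)
qed

lemma prob_Ball_ge:
  assumes "finite I" "\<And>i. i \<in> I \<Longrightarrow> measure_pmf.prob M {\<omega>. \<not> P i \<omega>} \<le> \<epsilon>"
  shows "1 - real (card I) * \<epsilon> \<le> measure_pmf.prob M {\<omega>. \<forall>i\<in>I. P i \<omega>}"
proof -
  have "measure_pmf.prob M (\<Union>i\<in>I. {\<omega>. \<not> P i \<omega>}) \<le> (\<Sum>i\<in>I. measure_pmf.prob M {\<omega>. \<not> P i \<omega>})"
    using assms(1) by (intro measure_UNION_le) auto
  also have "\<dots> \<le> real (card I) * \<epsilon>"
    using assms(2) by (intro sum_bounded_above) auto
  finally have "measure_pmf.prob M (\<Union>i\<in>I. {\<omega>. \<not> P i \<omega>}) \<le> real (card I) * \<epsilon>" .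
  moreover have "{\<omega>. \<forall>i\<in>I. P i \<omega>} = UNIV - (\<Union>i\<in>I. {\<omega>. \<not> P i \<omega>})"
    by auto
  ultimately show ?thesis
    using measure_pmf.prob_compl[of "\<Union>i\<in>I. {\<omega>. \<not> P i \<omega>}" M] by simp
qed

lemma prob_conj_ge:
  assumes "1 - a \<le> measure_pmf.prob M {\<omega>. P \<omega>}" "1 - b \<le> measure_pmf.prob M {\<omega>. Q \<omega>}"
  shows "1 - (a + b) \<le> measure_pmf.prob M {\<omega>. P \<omega> \<and> Q \<omega>}"
proof -
  have "measure_pmf.prob M {\<omega>. \<not> (P \<omega> \<and> Q \<omega>)} \<le>
      measure_pmf.prob M {\<omega>. \<not> P \<omega>} + measure_pmf.prob M {\<omega>. \<not> Q \<omega>}"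
    unfolding de_Morgan_conj Collect_disj_eq by (intro measure_Un_le) auto
  moreover have complement: "measure_pmf.prob M {\<omega>. \<not> R \<omega>} = 1 - measure_pmf.prob M {\<omega>. R \<omega>}" for R
    using measure_pmf.prob_compl[of "{\<omega>. R \<omega>}" M] by (simp add: Collect_neg_eq Compl_eq_Diff_UNIV)
  ultimately show ?thesis
    using assms complement[of P] complement[of Q] complement[of "\<lambda>\<omega>. P \<omega> \<and> Q \<omega>"] by linarith
qed

section \<open>Beam search\<close>

definition children :: "nat \<Rightarrow> nat option list \<Rightarrow> nat list \<Rightarrow> nat list" where
  "children n tab B = filter (\<lambda>y. tab ! y \<in> Some ` set B) [0..<n]"

definition parent_table :: "nat \<Rightarrow> nat set \<Rightarrow> nat list list \<Rightarrow> nat option list" where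
  "parent_table n M Bs =
     map (\<lambda>y. if y \<in> M \<and> Bs ! y \<noteq> [] then Some (hd (Bs ! y)) else None) [0..<n]"

definition parent_tables :: "nat \<Rightarrow> nat option list set" where
  "parent_tables n = {tab. set tab \<subseteq> insert None (Some ` {..<n}) \<and> length tab = n}"

definition tables :: "nat \<Rightarrow> nat \<Rightarrow> nat option list list set" where
  "tables n H = {tabs. set tabs \<subseteq> parent_tables n \<and> length tabs = H}"

definition refine_dtree ::
  "nat \<Rightarrow> nat \<Rightarrow> nat \<Rightarrow> 'x \<Rightarrow> nat option list \<Rightarrow> nat list \<Rightarrow> ('x, nat list) dtree" where
  "refine_dtree n cap width x tab B =
     bind_dtree (mergesort_dtree x (take cap (children n tab B))) (\<lambda>ys. Answer (take width ys))"

text \<open>On bad samples a beam may be empty, and \<open>hd B\<close> is then an arbitrary answer.\<close>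

primrec search_dtree ::
  "nat \<Rightarrow> nat \<Rightarrow> nat \<Rightarrow> nat option list list \<Rightarrow> nat list \<Rightarrow> (ref, nat) dtree" where
  "search_dtree n cap width [] B = Answer (hd B)"
| "search_dtree n cap width (tab # tabs) B =
     bind_dtree (refine_dtree n cap width Query tab B) (search_dtree n cap width tabs)"

text \<open>
  Links the levels below \<open>j\<close>, from the top down; \<open>Bs ! y\<close> is the beam of the object \<open>y\<close> in level \<open>j\<close>.
\<close>

primrec build_dtree ::
  "nat \<Rightarrow> nat \<Rightarrow> nat \<Rightarrow> (nat \<Rightarrow> nat set) \<Rightarrow> nat \<Rightarrow> nat list list \<Rightarrow>
     (nat, nat option list list) dtree" where
  "build_dtree n cap width lev 0 Bs = Answer []"
| "build_dtree n cap width lev (Suc j) Bs =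
     (let tab = parent_table n (lev j) Bs
      in bind_dtree (traverse_dtree (\<lambda>y. refine_dtree n cap width y tab (Bs ! y)) [0..<n])
           (\<lambda>Bs'. bind_dtree (build_dtree n cap width lev j Bs') (\<lambda>tabs. Answer (tab # tabs))))"

lemma set_children: "set (children n tab B) = {y. y < n \<and> tab ! y \<in> Some ` set B}"
  by (auto simp: children_def)

lemma distinct_children: "distinct (children n tab B)"
  by (simp add: children_def)

lemma outcome_refine_dtree_E:
  assumes "selects_min (orc x) key" "length (children n tab B) \<le> cap"
  obtains ys where "outcome orc (refine_dtree n cap width x tab B) = take width ys"
    "sorted (map key ys)" "distinct ys" "set ys = set (children n tab B)"
proof
  let ?ys = "outcome orc (mergesort_dtree x (children n tab B))"
  show "outcome orc (refine_dtree n cap width x tab B) = take width ?ys"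
    using assms(2) by (simp add: refine_dtree_def)
  show "sorted (map key ?ys)"
    using assms(1) by (rule sorted_outcome_mergesort_dtree)
  have mset_eq: "mset ?ys = mset (children n tab B)"
    by simp
  then show "set ?ys = set (children n tab B)"
    by (rule mset_eq_setD)
  show "distinct ?ys"
    using mset_eq_imp_distinct_iff[OF mset_eq] distinct_children[of n tab B] by simp
qed

lemma set_outcome_refine_dtree: "set (outcome orc (refine_dtree n cap width x tab B)) \<subseteq> {..<n}"
proof -
  have "set (outcome orc (mergesort_dtree x (take cap (children n tab B)))) =
      set (take cap (children n tab B))"
    by (intro mset_eq_setD mset_outcome_mergesort_dtree)
  then show ?thesis
    by (auto simp: refine_dtree_def set_children dest!: in_set_takeD)
qed

lemma length_asked_refine_dtree:
  "length (asked orc (refine_dtree n cap width x tab B)) \<le> ceillog2 cap * cap"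
proof -
  let ?us = "take cap (children n tab B)"
  have "length ?us \<le> 2 ^ ceillog2 cap"
    using le_two_power_ceillog2[of cap] by (simp add: min.coboundedI2)
  then have "length (asked orc (mergesort_dtree x ?us)) \<le> ceillog2 cap * length ?us"
    by (rule length_asked_mergesort_dtree)
  also have "\<dots> \<le> ceillog2 cap * cap"
    by (intro mult_left_mono) auto
  finally show ?thesis
    by (simp add: refine_dtree_def)
qed

lemma set_asked_refine_dtree:
  "set (asked orc (refine_dtree n cap width x tab B)) \<subseteq> {x} \<times> {..<n} \<times> {..<n}"
proof -
  let ?us = "take cap (children n tab B)"
  have "set ?us \<subseteq> {..<n}"
    by (auto simp: set_children dest!: in_set_takeD)
  then have "{x} \<times> set ?us \<times> set ?us \<subseteq> {x} \<times> {..<n} \<times> {..<n}"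
    by blast
  then show ?thesis
    using set_asked_mergesort_dtree[of orc x ?us] by (simp add: refine_dtree_def)
qed

lemma length_asked_search_dtree:
  "length (asked orc (search_dtree n cap width tabs B)) \<le> length tabs * (ceillog2 cap * cap)"
proof (induction tabs arbitrary: B)
  case (Cons tab tabs)
  then show ?case
    using length_asked_refine_dtree[of orc n cap width Query tab B] by (simp add: add_mono)
qed simp

lemma set_asked_search_dtree:
  "set (asked orc (search_dtree n cap width tabs B)) \<subseteq> {Query} \<times> {..<n} \<times> {..<n}"
proof (induction tabs arbitrary: B)
  case (Cons tab tabs)
  then show ?case
    using set_asked_refine_dtree[of orc n cap width Query tab B] by simp
qed simp

lemma length_asked_build_dtree:
  "length (asked orc (build_dtree n cap width lev j Bs)) \<le> j * (n * (ceillog2 cap * cap))"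
proof (induction j arbitrary: Bs)
  case (Suc j)
  let ?tab = "parent_table n (lev j) Bs"
  have "(\<Sum>y\<leftarrow>[0..<n]. length (asked orc (refine_dtree n cap width y ?tab (Bs ! y))))
      \<le> (\<Sum>y\<leftarrow>[0..<n]. ceillog2 cap * cap)"
    using length_asked_refine_dtree by (intro sum_list_mono) auto
  also have "\<dots> = n * (ceillog2 cap * cap)"
    by (simp add: sum_list_triv)
  finally show ?case
    using Suc by (simp add: Let_def length_concat comp_def add_mono)
qed simp

lemma set_asked_build_dtree:
  "set (asked orc (build_dtree n cap width lev j Bs)) \<subseteq> {..<n} \<times> {..<n} \<times> {..<n}"
proof (induction j arbitrary: Bs)
  case (Suc j)
  have "set (asked orc (refine_dtree n cap width y tab B)) \<subseteq> {..<n} \<times> {..<n} \<times> {..<n}"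
    if "y < n" for y tab B
    using set_asked_refine_dtree[of orc n cap width y tab B] that by auto
  then show ?case
    using Suc by (simp add: Let_def UN_subset_iff)
qed simp

lemma outcome_build_dtree_in_tables:
  assumes "\<And>y. y < n \<Longrightarrow> set (Bs ! y) \<subseteq> {..<n}"
  shows "outcome orc (build_dtree n cap width lev j Bs) \<in> tables n j"
  using assms
proof (induction j arbitrary: Bs)
  case 0
  then show ?case by (simp add: tables_def)
next
  case (Suc j)
  let ?tab = "parent_table n (lev j) Bs"
  let ?Bs = "map (\<lambda>y. outcome orc (refine_dtree n cap width y ?tab (Bs ! y))) [0..<n]"
  have "hd (Bs ! y) < n" if "y < n" "Bs ! y \<noteq> []" for y
    using Suc.prems[OF that(1)] hd_in_set[OF that(2)] by blast
  then have "?tab \<in> parent_tables n"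
    by (auto simp: parent_table_def parent_tables_def)
  moreover have "outcome orc (build_dtree n cap width lev j ?Bs) \<in> tables n j"
    by (intro Suc.IH) (simp add: set_outcome_refine_dtree)
  ultimately show ?case
    by (simp add: tables_def Let_def)
qed

section \<open>Correctness of the search on good samples\<close>

text \<open>
  The tail bounds lose a factor 2, so \<open>7\<close> has to lie strictly between \<open>2 \<cdot> 2\<close> and \<open>17 / 2\<close>, and
  \<open>615\<close> above \<open>2 \<cdot> 306\<close>.
\<close>

definition beam_width :: "nat \<Rightarrow> nat \<Rightarrow> nat" where
  "beam_width E L = 7 * E * L"

definition candidate_cap :: "nat \<Rightarrow> nat \<Rightarrow> nat" where
  "candidate_cap E L = 615 * E ^ 3 * L"

locale search_instance = ranked_set d S
  for d :: "'a \<Rightarrow> 'a \<Rightarrow> real" and S :: "'a set" +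
  fixes n E L H :: nat and obj :: "nat \<Rightarrow> 'a" and q :: 'a
  assumes n_gt_1: "1 < n" and E_pos: "1 \<le> E" and L_pos: "1 \<le> L" and H_pos: "0 < H"
    and inj_obj: "inj_on obj {..<n}"
    and S_eq: "S = insert q (obj ` {..<n})"
    and disorder: "disorder_inequalities d S (real E)"
    and n_le_top: "n \<le> L * (17 * E) ^ H"
    and inner_less_n: "\<And>j. 0 < j \<Longrightarrow> j < H \<Longrightarrow> L * (17 * E) ^ j < n"
begin

definition radius :: "nat \<Rightarrow> nat" where
  "radius j = L * (17 * E) ^ j"

definition rank_ball :: "'a \<Rightarrow> nat \<Rightarrow> nat set" where
  "rank_ball x r = {y. y < n \<and> rank x (obj y) \<le> r}"

definition sparse_samples :: "(nat \<Rightarrow> nat set) \<Rightarrow> nat \<Rightarrow> nat \<Rightarrow> bool" where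
  "sparse_samples lev c k \<longleftrightarrow>
     (\<forall>(x, j)\<in>S \<times> {..<H}. card (lev j \<inter> rank_ball x (c * radius j)) \<le> k)"

definition dense_samples :: "(nat \<Rightarrow> nat set) \<Rightarrow> nat \<Rightarrow> nat \<Rightarrow> bool" where
  "dense_samples lev c k \<longleftrightarrow>
     (\<forall>(x, j)\<in>S \<times> {..<H}. c * radius j < n \<longrightarrow> k < card (lev j \<inter> rank_ball x (c * radius j)))"

definition good_samples :: "(nat \<Rightarrow> nat set) \<Rightarrow> bool" where
  "good_samples lev \<longleftrightarrow>
     sparse_samples lev (2 * E) (beam_width E L) \<and>
     sparse_samples lev (306 * E ^ 3) (candidate_cap E L) \<and>
     dense_samples lev (17 * E) (beam_width E L) \<and>
     dense_samples lev 1 0"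

lemma sparse_samplesD:
  assumes "sparse_samples lev c k" "x \<in> S" "j < H"
  shows "card (lev j \<inter> rank_ball x (c * radius j)) \<le> k"
  using assms by (auto simp: sparse_samples_def)

lemma dense_samplesD:
  assumes "dense_samples lev c k" "x \<in> S" "j < H" "c * radius j < n"
  shows "k < card (lev j \<inter> rank_ball x (c * radius j))"
  using assms by (auto simp: dense_samples_def)

lemma obj_in_S: "y < n \<Longrightarrow> obj y \<in> S"
  by (simp add: S_eq)

lemma q_in_S: "q \<in> S"
  by (simp add: S_eq)

lemma card_S_le: "card S \<le> Suc n"
  unfolding S_eq using card_image_le[of "{..<n}" obj] by (simp add: card_insert_if)

lemma rank_le_n: "x \<in> S \<Longrightarrow> rank x y \<le> n"
  using rank_less_card[of x y] card_S_le by simp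

lemma radius_Suc: "radius (Suc j) = 17 * E * radius j"
  by (simp add: radius_def)

lemma radius_pos: "0 < radius j"
  using E_pos L_pos by (simp add: radius_def)

lemma rank_ball_mono: "r \<le> s \<Longrightarrow> rank_ball x r \<subseteq> rank_ball x s"
  by (auto simp: rank_ball_def)

lemma rank_ball_subset: "rank_ball x r \<subseteq> {..<n}"
  by (auto simp: rank_ball_def)

lemma finite_rank_ball [simp]: "finite (rank_ball x r)"
  by (simp add: rank_ball_def)

lemma rank_disorder_triangle:
  assumes "x \<in> S" "y \<in> S" "z \<in> S"
  shows "rank x y \<le> E * (rank x z + rank z y)"
    and "rank x y \<le> E * (rank x z + rank y z)"
proof -
  have "real (rank x y) \<le> real (E * (rank x z + rank z y))"
    "real (rank x y) \<le> real (E * (rank x z + rank y z))"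
    using disorder[unfolded disorder_inequalities_def, rule_format, OF assms] by simp_all
  then show "rank x y \<le> E * (rank x z + rank z y)" "rank x y \<le> E * (rank x z + rank y z)"
    by (simp_all only: of_nat_le_iff)
qed

lemma card_image_rank_ball: "card (obj ` rank_ball x r) = card (rank_ball x r)"
  by (rule card_image, rule inj_on_subset[OF inj_obj]) (auto simp: rank_ball_def)

lemma card_rank_ball_le:
  assumes "x \<in> S"
  shows "card (rank_ball x r) \<le> Suc r"
proof -
  have "card (rank_ball x r) \<le> card {y \<in> S. rank x y \<le> r}"
    unfolding card_image_rank_ball[symmetric] using finite_S obj_in_S
    by (intro card_mono) (auto simp: rank_ball_def)
  then show ?thesis
    by (simp add: card_rank_le[OF assms])
qed

lemma card_rank_ball_ge:
  assumes "x \<in> S" "r < n"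
  shows "r \<le> card (rank_ball x r)"
proof -
  have "n \<le> card S"
    using card_mono[of S "obj ` {..<n}"] finite_S card_image[OF inj_obj] by (auto simp: S_eq)
  then have "Suc r = card {y \<in> S. rank x y \<le> r}"
    using assms(2) by (simp add: card_rank_le[OF assms(1)])
  also have "\<dots> \<le> card (insert q (obj ` rank_ball x r))"
  proof (intro card_mono subsetI)
    fix y assume "y \<in> {y \<in> S. rank x y \<le> r}"
    then consider "y = q" | i where "i < n" "y = obj i" "rank x (obj i) \<le> r"
      using S_eq by blast
    then show "y \<in> insert q (obj ` rank_ball x r)"
      by cases (auto simp: rank_ball_def)
  qed simp
  also have "\<dots> \<le> Suc (card (rank_ball x r))"
    by (simp add: card_insert_if card_image_rank_ball)
  finally show ?thesis by simp
qed

end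

locale good_hierarchy = search_instance +
  fixes lev :: "nat \<Rightarrow> nat set"
  assumes top_level: "lev H = {0}" and bottom_level: "lev 0 = {..<n}"
    and good: "good_samples lev"
begin

definition good_beam :: "'a \<Rightarrow> nat \<Rightarrow> nat list \<Rightarrow> bool" where
  "good_beam x j B \<longleftrightarrow>
     sorted (map (\<lambda>y. d (obj y) x) B) \<and>
     lev j \<inter> rank_ball x (2 * E * radius j) \<subseteq> set B \<and>
     set B \<subseteq> lev j \<inter> rank_ball x (17 * E * radius j)"

definition good_table :: "nat \<Rightarrow> nat option list \<Rightarrow> bool" where
  "good_table j tab \<longleftrightarrow> (\<forall>y<n. case tab ! y of
       None \<Rightarrow> y \<notin> lev j
     | Some p \<Rightarrow> y \<in> lev j \<and> p \<in> lev (Suc j) \<inter> rank_ball (obj y) (radius (Suc j)))"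

lemma good_beam_top:
  assumes "x \<in> S"
  shows "good_beam x H [0]"
proof -
  have "rank x (obj 0) \<le> radius H"
    using rank_le_n[OF assms, of "obj 0"] n_le_top by (simp add: radius_def)
  also have "\<dots> \<le> 17 * E * radius H"
    using E_pos by simp
  finally show ?thesis
    using n_gt_1 by (simp add: good_beam_def rank_ball_def top_level)
qed

lemma dist_hd_good_beam:
  assumes "good_beam x j B" "y \<in> lev j \<inter> rank_ball x (2 * E * radius j)"
  shows "hd B \<in> set B" "d (obj (hd B)) x \<le> d (obj y) x"
proof -
  have "y \<in> set B"
    using assms by (auto simp: good_beam_def)
  then show "hd B \<in> set B" "d (obj (hd B)) x \<le> d (obj y) x"
    using assms(1) by (cases B; auto simp: good_beam_def)+
qed

lemma ex_sample_in_radius: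
  assumes "x \<in> S" "0 < j" "j \<le> H"
  shows "lev j \<inter> rank_ball x (radius j) \<noteq> {}"
proof (cases "j = H")
  case True
  then show ?thesis
    using rank_le_n[OF assms(1), of "obj 0"] n_le_top n_gt_1
    by (auto simp: top_level rank_ball_def radius_def)
next
  case False
  then have "radius j < n"
    using assms(2,3) inner_less_n by (simp add: radius_def)
  then have "0 < card (lev j \<inter> rank_ball x (radius j))"
    using dense_samplesD[of lev 1 0 x j] good assms False by (simp add: good_samples_def)
  then show ?thesis
    by (auto simp: card_gt_0_iff)
qed

lemma hd_good_beam:
  assumes "x \<in> S" "0 < j" "j \<le> H" "good_beam x j B"
  shows "B \<noteq> []" "hd B \<in> lev j \<inter> rank_ball x (radius j)"
proof -
  obtain y where y: "y \<in> lev j \<inter> rank_ball x (radius j)"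
    using ex_sample_in_radius[OF assms(1-3)] by blast
  have "radius j \<le> 2 * E * radius j"
    using E_pos by simp
  then have "y \<in> lev j \<inter> rank_ball x (2 * E * radius j)"
    using y rank_ball_mono by blast
  note hd = dist_hd_good_beam[OF assms(4) this]
  then show "B \<noteq> []"
    by auto
  have "rank x (obj (hd B)) \<le> radius j"
    using rank_mono[OF hd(2)] y by (auto simp: rank_ball_def)
  then show "hd B \<in> lev j \<inter> rank_ball x (radius j)"
    using assms(4) hd(1) by (auto simp: good_beam_def rank_ball_def)
qed

lemma good_parent_table:
  assumes "j < H" "\<And>y. y < n \<Longrightarrow> good_beam (obj y) (Suc j) (Bs ! y)"
  shows "good_table j (parent_table n (lev j) Bs)"
  using hd_good_beam[OF obj_in_S _ _ assms(2)] assms(1)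
  by (simp add: good_table_def parent_table_def)

lemma samples_subset_children:
  assumes "x \<in> S" "good_table j tab" "good_beam x (Suc j) B"
  shows "lev j \<inter> rank_ball x (radius (Suc j)) \<subseteq> set (children n tab B)"
proof
  fix y assume y: "y \<in> lev j \<inter> rank_ball x (radius (Suc j))"
  then have "y < n" and rank_y: "rank x (obj y) \<le> radius (Suc j)"
    by (auto simp: rank_ball_def)
  obtain p where p: "tab ! y = Some p" "p \<in> lev (Suc j)" "p < n"
    and rank_p: "rank (obj y) (obj p) \<le> radius (Suc j)"
    using assms(2) y \<open>y < n\<close> by (fastforce simp: good_table_def rank_ball_def split: option.splits)
  have "rank x (obj p) \<le> E * (rank x (obj y) + rank (obj y) (obj p))"
    using p(3) \<open>y < n\<close> assms(1) by (intro rank_disorder_triangle obj_in_S)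
  also have "\<dots> \<le> E * (radius (Suc j) + radius (Suc j))"
    using rank_y rank_p by (intro mult_left_mono add_mono) auto
  finally have "p \<in> lev (Suc j) \<inter> rank_ball x (2 * E * radius (Suc j))"
    using p by (simp add: rank_ball_def algebra_simps)
  then show "y \<in> set (children n tab B)"
    using assms(3) p(1) \<open>y < n\<close> by (auto simp: set_children good_beam_def)
qed

lemma children_subset_samples:
  assumes "x \<in> S" "good_table j tab" "good_beam x (Suc j) B"
  shows "set (children n tab B) \<subseteq> lev j \<inter> rank_ball x (306 * E ^ 3 * radius j)"
proof
  fix y assume "y \<in> set (children n tab B)"
  then obtain p where "y < n" and p: "tab ! y = Some p" "p \<in> set B"
    by (auto simp: set_children)
  then have y: "y \<in> lev j" and rank_p: "p < n" "rank (obj y) (obj p) \<le> radius (Suc j)"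
      "rank x (obj p) \<le> 17 * E * radius (Suc j)"
    using assms(2,3) by (auto simp: good_table_def good_beam_def rank_ball_def split: option.splits)
  have "rank x (obj y) \<le> E * (rank x (obj p) + rank (obj y) (obj p))"
    using rank_p(1) \<open>y < n\<close> assms(1) by (intro rank_disorder_triangle obj_in_S)
  also have "\<dots> \<le> E * (17 * E * radius (Suc j) + E * radius (Suc j))"
    using rank_p E_pos by (intro mult_left_mono add_mono) (auto intro: order_trans)
  also have "\<dots> = 306 * E ^ 3 * radius j"
    by (simp add: radius_Suc power3_eq_cube algebra_simps)
  finally show "y \<in> lev j \<inter> rank_ball x (306 * E ^ 3 * radius j)"
    using y \<open>y < n\<close> by (simp add: rank_ball_def)
qed

lemma length_children_le:
  assumes "x \<in> S" "j < H" "good_table j tab" "good_beam x (Suc j) B"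
  shows "length (children n tab B) \<le> candidate_cap E L"
proof -
  have "length (children n tab B) = card (set (children n tab B))"
    by (simp add: distinct_card distinct_children)
  also have "\<dots> \<le> card (lev j \<inter> rank_ball x (306 * E ^ 3 * radius j))"
    using children_subset_samples[OF assms(1,3,4)] by (intro card_mono) auto
  also have "\<dots> \<le> candidate_cap E L"
    using good assms(1,2) by (simp add: good_samples_def sparse_samplesD)
  finally show ?thesis .
qed

lemma good_beam_take:
  assumes "x \<in> S" "j < H" "distinct ys" "sorted (map (\<lambda>y. d (obj y) x) ys)"
    and lower: "lev j \<inter> rank_ball x (17 * E * radius j) \<subseteq> set ys"
    and upper: "set ys \<subseteq> lev j \<inter> {..<n}"
  shows "good_beam x j (take (beam_width E L) ys)"
proof -
  let ?rank = "\<lambda>y. rank x (obj y)" and ?inner = "2 * E * radius j" and ?outer = "17 * E * radius j"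
  have sorted_rank: "sorted (map ?rank ys)"
    using assms(4) by (simp add: sorted_map) (erule sorted_wrt_mono_rel[rotated], rule rank_mono)
  have ys_ball: "{y \<in> set ys. ?rank y \<le> r} = lev j \<inter> rank_ball x r" if "r \<le> ?outer" for r
    using lower upper rank_ball_mono[OF that, of x] by (auto simp: rank_ball_def)
  have "card {y \<in> set ys. ?rank y \<le> ?inner} \<le> beam_width E L"
    using good assms(1,2) by (simp add: ys_ball good_samples_def sparse_samplesD)
  from sorted_take_superset[OF sorted_rank assms(3) this]
  have "lev j \<inter> rank_ball x ?inner \<subseteq> set (take (beam_width E L) ys)"
    by (simp add: ys_ball)
  moreover have "set (take (beam_width E L) ys) \<subseteq> {y \<in> set ys. ?rank y \<le> ?outer}"
  proof (cases "?outer < n")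
    case True
    then have "beam_width E L \<le> card {y \<in> set ys. ?rank y \<le> ?outer}"
      using good assms(1,2) by (simp add: ys_ball good_samples_def dense_samplesD less_imp_le)
    then show ?thesis
      by (rule sorted_take_subset[OF sorted_rank assms(3)])
  next
    case False
    then have "?rank y \<le> ?outer" for y
      using rank_le_n[OF assms(1), of "obj y"] by linarith
    then show ?thesis
      using set_take_subset[of _ ys] by auto
  qed
  then have "set (take (beam_width E L) ys) \<subseteq> lev j \<inter> rank_ball x ?outer"
    by (simp add: ys_ball)
  moreover have "sorted (map (\<lambda>y. d (obj y) x) (take (beam_width E L) ys))"
    using assms(4) by (simp add: sorted_wrt_take flip: take_map)
  ultimately show ?thesis
    by (simp add: good_beam_def)
qed

lemma good_beam_refine:
  assumes "x \<in> S" "j < H" "good_table j tab" "good_beam x (Suc j) B"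
    and "selects_min (orc r) (\<lambda>y. d (obj y) x)"
  shows "good_beam x j
    (outcome orc (refine_dtree n (candidate_cap E L) (beam_width E L) r tab B))"
proof -
  obtain ys where ys: "sorted (map (\<lambda>y. d (obj y) x) ys)" "distinct ys"
      "set ys = set (children n tab B)"
    and out: "outcome orc (refine_dtree n (candidate_cap E L) (beam_width E L) r tab B) =
      take (beam_width E L) ys"
    using outcome_refine_dtree_E[where orc = orc and x = r,
        OF assms(5) length_children_le[OF assms(1-4)]] by metis
  have "lev j \<inter> rank_ball x (17 * E * radius j) \<subseteq> set ys"
    using samples_subset_children[OF assms(1,3,4)] by (simp add: ys(3) radius_Suc)
  moreover have "set ys \<subseteq> lev j \<inter> {..<n}"
    using children_subset_samples[OF assms(1,3,4)] by (auto simp: ys(3) set_children)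
  ultimately show ?thesis
    unfolding out using assms(1,2) ys(1,2) by (intro good_beam_take)
qed

lemma nearest_hd_good_beam:
  assumes "x \<in> S" "good_beam x 0 B"
  shows "hd B < n" "nearest_neighbor d (obj ` {..<n}) x (obj (hd B))"
proof -
  have "1 \<le> 2 * E * radius 0"
    using E_pos radius_pos[of 0] by simp
  then have "rank_ball x 1 \<subseteq> lev 0 \<inter> rank_ball x (2 * E * radius 0)"
    unfolding bottom_level using rank_ball_mono rank_ball_subset by blast
  then have in_beam: "y \<in> lev 0 \<inter> rank_ball x (2 * E * radius 0)" if "y \<in> rank_ball x 1" for y
    using that by blast
  have "1 \<le> card (rank_ball x 1)"
    using n_gt_1 by (intro card_rank_ball_ge assms(1))
  then obtain y0 where y0: "y0 \<in> rank_ball x 1"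
    by fastforce
  then have "hd B \<in> set B"
    using dist_hd_good_beam(1)[OF assms(2) in_beam] by blast
  then show "hd B < n"
    using assms(2) by (auto simp: good_beam_def rank_ball_def)
  have "d (obj (hd B)) x \<le> d (obj y) x" if "y < n" for y
  proof (cases "y \<in> rank_ball x 1")
    case True
    then show ?thesis
      using dist_hd_good_beam(2)[OF assms(2) in_beam] by blast
  next
    case False
    then have "d (obj y0) x \<le> d (obj y) x"
      using y0 that rank_mono[of "obj y" x "obj y0"] by (force simp: rank_ball_def)
    then show ?thesis
      using dist_hd_good_beam(2)[OF assms(2) in_beam[OF y0]] by linarith
  qed
  then show "nearest_neighbor d (obj ` {..<n}) x (obj (hd B))"
    using \<open>hd B < n\<close> by (auto simp: nearest_neighbor_def)
qed

lemma outcome_search_dtree_nearest: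
  assumes "j \<le> H" "\<And>y. y < n \<Longrightarrow> good_beam (obj y) j (Bs ! y)" "good_beam q j B"
  defines "cap \<equiv> candidate_cap E L" and "width \<equiv> beam_width E L"
  defines "z \<equiv> outcome (search_oracle d obj q) (search_dtree n cap width
     (outcome (build_oracle d obj) (build_dtree n cap width lev j Bs)) B)"
  shows "z < n \<and> nearest_neighbor d (obj ` {..<n}) q (obj z)"
  using assms(1-3) unfolding z_def
proof (induction j arbitrary: Bs B)
  case 0
  then show ?case
    using nearest_hd_good_beam[OF q_in_S] by simp
next
  case (Suc j)
  let ?tab = "parent_table n (lev j) Bs"
  let ?Bs = "map (\<lambda>y. outcome (build_oracle d obj)
    (refine_dtree n cap width y ?tab (Bs ! y))) [0..<n]"
  let ?B = "outcome (search_oracle d obj q) (refine_dtree n cap width Query ?tab B)"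
  have j: "j < H"
    using Suc.prems(1) by simp
  have tab: "good_table j ?tab"
    using j Suc.prems(2) by (rule good_parent_table)
  have "good_beam (obj y) j (?Bs ! y)" if "y < n" for y
    using good_beam_refine[OF obj_in_S[OF that] j tab Suc.prems(2)[OF that],
        of "build_oracle d obj" y] that
    by (simp add: cap_def width_def selects_min_build_oracle)
  moreover have "good_beam q j ?B"
    using good_beam_refine[OF q_in_S j tab Suc.prems(3), of "search_oracle d obj q" Query]
      selects_min_search_oracle[of d obj q Query]
    by (simp add: cap_def width_def)
  ultimately show ?case
    using Suc.IH[of ?Bs ?B] j by (simp add: Let_def)
qed

end

section \<open>Random levels\<close>

definition sample_levels :: "nat \<Rightarrow> nat \<Rightarrow> nat \<Rightarrow> (nat \<Rightarrow> nat set) pmf" where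
  "sample_levels n b H = Pi_pmf {..<H} {0} (\<lambda>j. random_subset (1 / real b ^ j) {..<n})"

lemma sample_levels_top:
  assumes "lev \<in> set_pmf (sample_levels n b H)"
  shows "lev H = {0}"
  using assms by (auto simp: sample_levels_def set_Pi_pmf PiE_dflt_def)

lemma sample_levels_bottom:
  assumes "lev \<in> set_pmf (sample_levels n b H)" "0 < H"
  shows "lev 0 = {..<n}"
proof -
  have "lev 0 \<in> set_pmf (random_subset (1 / real b ^ 0) {..<n})"
    using assms by (auto simp: sample_levels_def set_Pi_pmf PiE_dflt_def)
  then show ?thesis
    by (simp add: random_subset_1)
qed

lemma prob_card_level:
  assumes "j < H" "B \<subseteq> {..<n}" "1 \<le> b"
  shows "measure_pmf.prob (sample_levels n b H) {lev. P (card (lev j \<inter> B))} =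
    measure_pmf.prob (binomial_pmf (card B) (1 / real b ^ j)) {k. P k}"
proof -
  have "1 / real b ^ j \<in> {0..1}"
    using assms(3) by (simp add: divide_le_eq_1 one_le_power)
  then have "binomial_pmf (card B) (1 / real b ^ j) =
      map_pmf (\<lambda>M. card (M \<inter> B)) (random_subset (1 / real b ^ j) {..<n})"
    using assms(2) by (simp add: map_pmf_card_random_subset)
  also have "random_subset (1 / real b ^ j) {..<n} = map_pmf (\<lambda>lev. lev j) (sample_levels n b H)"
    using assms(1) by (simp add: sample_levels_def Pi_pmf_component)
  finally show ?thesis
    by (simp add: pmf.map_comp comp_def vimage_def)
qed

context search_instance
begin

abbreviation samples :: "(nat \<Rightarrow> nat set) pmf" where
  "samples \<equiv> sample_levels n (17 * E) H"

lemma sampling_probability: "1 / real (17 * E) ^ j \<in> {0..1}"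
proof -
  have "1 \<le> real (17 * E)"
    using E_pos by simp
  then show ?thesis
    by (simp add: divide_le_eq_1 one_le_power del: of_nat_mult)
qed

lemma expected_samples_in_radius: "1 / real (17 * E) ^ j * real (c * radius j) = real (c * L)"
  using E_pos by (simp add: radius_def)

lemma prob_level_not_sparse:
  assumes "x \<in> S" "j < H" "4 * (c * L + 1) + L \<le> 2 * k"
  shows "measure_pmf.prob samples
    {lev. \<not> card (lev j \<inter> rank_ball x (c * radius j)) \<le> k} \<le> exp (- real L / 2)"
proof -
  let ?p = "1 / real (17 * E) ^ j" and ?m = "card (rank_ball x (c * radius j))"
  have "?p * real ?m \<le> ?p * real (c * radius j + 1)"
    using card_rank_ball_le[OF assms(1), of "c * radius j"]
    by (intro mult_left_mono) (auto simp del: of_nat_mult)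
  also have "\<dots> \<le> real (c * L) + 1"
    using sampling_probability[of j] expected_samples_in_radius[of j c]
    by (simp add: distrib_left del: of_nat_mult)
  finally have mean: "?p * real ?m \<le> real (c * L) + 1" .
  have "measure_pmf.prob samples
      {lev. \<not> card (lev j \<inter> rank_ball x (c * radius j)) \<le> k} =
      measure_pmf.prob (binomial_pmf ?m ?p) {i. \<not> i \<le> k}"
    using E_pos by (intro prob_card_level assms(2) rank_ball_subset) simp
  also have "\<dots> \<le> measure_pmf.prob (binomial_pmf ?m ?p) {i. real k \<le> real i}"
    by (intro measure_pmf.finite_measure_mono) auto
  also have "\<dots> \<le> exp (2 * (real (c * L) + 1) - real k)"
    using sampling_probability mean by (rule binomial_pmf_upper_tail)
  also have "\<dots> \<le> exp (- real L / 2)"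
    using of_nat_mono[OF assms(3), where 'a = real] by simp
  finally show ?thesis .
qed

lemma prob_level_not_dense:
  assumes "x \<in> S" "j < H" "2 * k + L \<le> c * L"
  shows "measure_pmf.prob samples
    {lev. \<not> (c * radius j < n \<longrightarrow> k < card (lev j \<inter> rank_ball x (c * radius j)))}
    \<le> exp (- real L / 2)"
proof (cases "c * radius j < n")
  case True
  let ?p = "1 / real (17 * E) ^ j" and ?m = "card (rank_ball x (c * radius j))"
  have "real (c * L) = ?p * real (c * radius j)"
    by (rule expected_samples_in_radius[symmetric])
  also have "\<dots> \<le> ?p * real ?m"
    using card_rank_ball_ge[OF assms(1) True]
    by (intro mult_left_mono) (auto simp del: of_nat_mult)
  finally have mean: "real (c * L) \<le> ?p * real ?m" .
  have "measure_pmf.prob samples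
      {lev. \<not> (c * radius j < n \<longrightarrow> k < card (lev j \<inter> rank_ball x (c * radius j)))} =
      measure_pmf.prob (binomial_pmf ?m ?p) {i. \<not> (c * radius j < n \<longrightarrow> k < i)}"
    using E_pos by (intro prob_card_level assms(2) rank_ball_subset) simp
  also have "\<dots> = measure_pmf.prob (binomial_pmf ?m ?p) {i. real i \<le> real k}"
    using True by (simp add: not_less)
  also have "\<dots> \<le> exp (real k - real (c * L) / 2)"
    using sampling_probability mean by (rule binomial_pmf_lower_tail)
  also have "\<dots> \<le> exp (- real L / 2)"
    using of_nat_mono[OF assms(3), where 'a = real] by simp
  finally show ?thesis .
qed simp

lemma prob_all_points_levels:
  assumes "\<And>x j. x \<in> S \<Longrightarrow> j < H \<Longrightarrow> measure_pmf.prob M {\<omega>. \<not> P x j \<omega>} \<le> \<epsilon>" "0 \<le> \<epsilon>"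
  shows "1 - real (Suc n * H) * \<epsilon> \<le> measure_pmf.prob M {\<omega>. \<forall>(x, j)\<in>S \<times> {..<H}. P x j \<omega>}"
proof -
  have "card (S \<times> {..<H}) \<le> Suc n * H"
    using card_S_le by (simp add: card_cartesian_product del: mult_Suc)
  then have "1 - real (Suc n * H) * \<epsilon> \<le> 1 - real (card (S \<times> {..<H})) * \<epsilon>"
    using assms(2) by (intro diff_left_mono mult_right_mono of_nat_mono)
  also have "\<dots> \<le> measure_pmf.prob M {\<omega>. \<forall>(x, j)\<in>S \<times> {..<H}. P x j \<omega>}"
    using finite_S assms(1) by (intro prob_Ball_ge) (auto simp: split_beta)
  finally show ?thesis .
qed

lemma prob_sparse_samples:
  assumes "4 * (c * L + 1) + L \<le> 2 * k"
  shows "1 - real (Suc n * H) * exp (- real L / 2) \<le>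
    measure_pmf.prob samples {lev. sparse_samples lev c k}"
  unfolding sparse_samples_def
  using prob_level_not_sparse[OF _ _ assms] by (rule prob_all_points_levels) simp_all

lemma prob_dense_samples:
  assumes "2 * k + L \<le> c * L"
  shows "1 - real (Suc n * H) * exp (- real L / 2) \<le>
    measure_pmf.prob samples {lev. dense_samples lev c k}"
  unfolding dense_samples_def
  using prob_level_not_dense[OF _ _ assms] by (rule prob_all_points_levels) simp_all

lemma prob_good_samples:
  "1 - 4 * (real (Suc n * H) * exp (- real L / 2)) \<le>
    measure_pmf.prob samples {lev. good_samples lev}"
proof -
  define \<epsilon> where "\<epsilon> = real (Suc n * H) * exp (- real L / 2)"
  define EL E3L where "EL = E * L" and "E3L = E ^ 3 * L"
  have "L \<le> EL" "L \<le> E3L"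
    using E_pos by (simp_all add: EL_def E3L_def)
  then have margins: "4 * (2 * E * L + 1) + L \<le> 2 * beam_width E L"
      "4 * (306 * E ^ 3 * L + 1) + L \<le> 2 * candidate_cap E L"
      "2 * beam_width E L + L \<le> 17 * E * L"
    unfolding beam_width_def candidate_cap_def mult.assoc EL_def[symmetric] E3L_def[symmetric]
    using L_pos by simp_all
  have "1 - (\<epsilon> + (\<epsilon> + (\<epsilon> + \<epsilon>))) \<le>
      measure_pmf.prob samples {lev. good_samples lev}"
    unfolding good_samples_def \<epsilon>_def
    by (intro prob_conj_ge prob_sparse_samples prob_dense_samples margins) simp
  then show ?thesis
    by (simp add: \<epsilon>_def)
qed

end

section \<open>Bit encodings\<close>

lemma ex_inj_on_bit_lists:
  assumes "finite A"
  shows "\<exists>f. f ` A \<subseteq> {bs :: bool list. length bs = ceillog2 (card A)} \<and> inj_on f A"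
proof (rule card_le_inj[OF assms])
  let ?m = "ceillog2 (card A)"
  have bit_lists: "{bs. length bs = ?m} = {bs :: bool list. set bs \<subseteq> UNIV \<and> length bs = ?m}"
    by simp
  show "finite {bs :: bool list. length bs = ?m}"
    unfolding bit_lists by (rule finite_lists_length_eq) simp
  have "card {bs :: bool list. length bs = ?m} = 2 ^ ?m"
    unfolding bit_lists by (subst card_lists_length_eq) auto
  then show "card A \<le> card {bs :: bool list. length bs = ?m}"
    using le_two_power_ceillog2 by simp
qed

text \<open>Only the number of stored bits matters, so any injection into bit strings will do.\<close>

definition bit_encoding :: "'b set \<Rightarrow> 'b \<Rightarrow> bool list" where
  "bit_encoding A = (SOME f. f ` A \<subseteq> {bs. length bs = ceillog2 (card A)} \<and> inj_on f A)"

lemma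
  assumes "finite A" "a \<in> A"
  shows length_bit_encoding: "length (bit_encoding A a) = ceillog2 (card A)"
    and inv_into_bit_encoding: "inv_into A (bit_encoding A) (bit_encoding A a) = a"
  using someI_ex[OF ex_inj_on_bit_lists[OF assms(1)]] assms(2) unfolding bit_encoding_def by auto

lemma finite_parent_tables: "finite (parent_tables n)"
  unfolding parent_tables_def by (rule finite_lists_length_eq) simp

lemma card_parent_tables: "card (parent_tables n) = Suc n ^ n"
proof -
  have "card (insert None (Some ` {..<n})) = Suc n"
    by (simp add: card_insert_if card_image)
  then show ?thesis
    by (simp add: parent_tables_def card_lists_length_eq)
qed

lemma finite_tables: "finite (tables n H)"
  unfolding tables_def using finite_parent_tables by (rule finite_lists_length_eq)

lemma card_tables: "card (tables n H) = Suc n ^ (n * H)"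
  unfolding tables_def card_lists_length_eq[OF finite_parent_tables]
  by (simp add: card_parent_tables power_mult)

section \<open>The data structure\<close>

definition link_dtree ::
  "nat \<Rightarrow> nat \<Rightarrow> nat \<Rightarrow> nat \<Rightarrow> (nat \<Rightarrow> nat set) \<Rightarrow> (nat, nat option list list) dtree" where
  "link_dtree n E L H lev =
     build_dtree n (candidate_cap E L) (beam_width E L) lev H (replicate n [0])"

definition hierarchy_dtree ::
  "nat \<Rightarrow> nat \<Rightarrow> nat \<Rightarrow> nat \<Rightarrow> (nat \<Rightarrow> nat set) \<Rightarrow> (nat, bool list) dtree" where
  "hierarchy_dtree n E L H lev =
     bind_dtree (link_dtree n E L H lev) (\<lambda>tabs. Answer (bit_encoding (tables n H) tabs))"

definition hierarchy_build :: "nat \<Rightarrow> nat \<Rightarrow> nat \<Rightarrow> nat \<Rightarrow> (nat, bool list) dtree pmf" where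
  "hierarchy_build n E L H = map_pmf (hierarchy_dtree n E L H) (sample_levels n (17 * E) H)"

definition hierarchy_search :: "nat \<Rightarrow> nat \<Rightarrow> nat \<Rightarrow> nat \<Rightarrow> bool list \<Rightarrow> (ref, nat) dtree pmf" where
  "hierarchy_search n E L H bs = return_pmf (search_dtree n (candidate_cap E L) (beam_width E L)
     (inv_into (tables n H) (bit_encoding (tables n H)) bs) [0])"

definition level_cost :: "nat \<Rightarrow> nat \<Rightarrow> nat" where
  "level_cost E L = ceillog2 (candidate_cap E L) * candidate_cap E L"

lemma outcome_link_dtree_in_tables:
  assumes "0 < n"
  shows "outcome orc (link_dtree n E L H lev) \<in> tables n H"
  unfolding link_dtree_def using assms by (intro outcome_build_dtree_in_tables) simp

lemma asked_hierarchy_dtree [simp]: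
  "asked orc (hierarchy_dtree n E L H lev) = asked orc (link_dtree n E L H lev)"
  by (simp add: hierarchy_dtree_def)

lemma outcome_hierarchy_dtree [simp]:
  "outcome orc (hierarchy_dtree n E L H lev) =
     bit_encoding (tables n H) (outcome orc (link_dtree n E L H lev))"
  by (simp add: hierarchy_dtree_def)

lemma hierarchy_build_costs:
  assumes "0 < n" "b \<in> set_pmf (hierarchy_build n E L H)"
  shows "set (asked orc b) \<subseteq> {..<n} \<times> {..<n} \<times> {..<n}"
    and "length (asked orc b) \<le> n * (H * level_cost E L)"
    and "length (outcome orc b) = ceillog2 (card (tables n H))"
proof -
  obtain lev where b: "b = hierarchy_dtree n E L H lev"
    using assms(2) by (auto simp: hierarchy_build_def)
  show "set (asked orc b) \<subseteq> {..<n} \<times> {..<n} \<times> {..<n}"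
    by (simp add: b link_dtree_def set_asked_build_dtree)
  show "length (asked orc b) \<le> n * (H * level_cost E L)"
    using length_asked_build_dtree[of orc n "candidate_cap E L" _ lev H]
    by (simp add: b link_dtree_def level_cost_def mult.left_commute)
  show "length (outcome orc b) = ceillog2 (card (tables n H))"
    by (simp add: b length_bit_encoding finite_tables outcome_link_dtree_in_tables[OF assms(1)])
qed

lemma hierarchy_search_hierarchy_dtree:
  assumes "0 < n"
  shows "hierarchy_search n E L H (outcome orc (hierarchy_dtree n E L H lev)) =
    return_pmf (search_dtree n (candidate_cap E L) (beam_width E L)
      (outcome orc (link_dtree n E L H lev)) [0])"
  by (simp add: hierarchy_search_def inv_into_bit_encoding finite_tables
      outcome_link_dtree_in_tables[OF assms])

lemma hierarchy_search_costs:
  assumes "0 < n" "b \<in> set_pmf (hierarchy_build n E L H)"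
    and "s \<in> set_pmf (hierarchy_search n E L H (outcome orc b))"
  shows "set (asked orc' s) \<subseteq> insert Query (Stored ` {..<n}) \<times> {..<n} \<times> {..<n}"
    and "length (asked orc' s) \<le> H * level_cost E L"
proof -
  obtain lev where b: "b = hierarchy_dtree n E L H lev"
    using assms(2) by (auto simp: hierarchy_build_def)
  define tabs where "tabs = outcome orc (link_dtree n E L H lev)"
  have s: "s = search_dtree n (candidate_cap E L) (beam_width E L) tabs [0]"
    using assms(3) unfolding b hierarchy_search_hierarchy_dtree[OF assms(1)] by (simp add: tabs_def)
  have "length tabs = H"
    using outcome_link_dtree_in_tables[OF assms(1)] by (simp add: tabs_def tables_def)
  then show "length (asked orc' s) \<le> H * level_cost E L"
    using length_asked_search_dtree[of orc' n "candidate_cap E L" _ tabs]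
    by (auto simp: s level_cost_def)
  show "set (asked orc' s) \<subseteq> insert Query (Stored ` {..<n}) \<times> {..<n} \<times> {..<n}"
    unfolding s by (rule order_trans[OF set_asked_search_dtree]) auto
qed

lemma bind_hierarchy_build_hierarchy_search:
  assumes "0 < n"
  shows "hierarchy_build n E L H \<bind>
      (\<lambda>b. map_pmf (outcome orc') (hierarchy_search n E L H (outcome orc b))) =
    map_pmf (\<lambda>lev. outcome orc' (search_dtree n (candidate_cap E L) (beam_width E L)
      (outcome orc (link_dtree n E L H lev)) [0])) (sample_levels n (17 * E) H)"
  unfolding hierarchy_build_def bind_map_pmf map_return_pmf hierarchy_search_hierarchy_dtree[OF assms]
  by (simp add: map_pmf_def)

lemma (in search_instance) prob_nearest_neighbor_found:
  "1 - 4 * (real (Suc n * H) * exp (- real L / 2)) \<le> measure_pmf.prob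
     (hierarchy_build n E L H \<bind> (\<lambda>b. map_pmf (outcome (search_oracle d obj q))
        (hierarchy_search n E L H (outcome (build_oracle d obj) b))))
     {i. i < n \<and> nearest_neighbor d (obj ` {..<n}) q (obj i)}"
proof -
  define found where "found lev = outcome (search_oracle d obj q)
    (search_dtree n (candidate_cap E L) (beam_width E L)
      (outcome (build_oracle d obj) (link_dtree n E L H lev)) [0])" for lev
  have found_nearest: "found lev < n \<and> nearest_neighbor d (obj ` {..<n}) q (obj (found lev))"
    if "lev \<in> set_pmf samples" "good_samples lev" for lev
  proof -
    interpret good_hierarchy d S n E L H obj q lev
      using that H_pos by unfold_locales (simp_all add: sample_levels_top sample_levels_bottom)
    have "good_beam (obj y) H (replicate n [0] ! y)" if "y < n" for y
      using good_beam_top[OF obj_in_S[OF that]] that by simp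
    then show ?thesis
      unfolding found_def link_dtree_def
      by (rule outcome_search_dtree_nearest[OF order_refl _ good_beam_top[OF q_in_S]])
  qed
  have "measure_pmf.prob samples {lev. good_samples lev} \<le>
      measure_pmf.prob samples
        (found -` {i. i < n \<and> nearest_neighbor d (obj ` {..<n}) q (obj i)})"
    using found_nearest
    by (intro measure_pmf.finite_measure_mono_AE) (auto simp: AE_measure_pmf_iff)
  then show ?thesis
    using prob_good_samples n_gt_1
    by (simp add: bind_hierarchy_build_hierarchy_search found_def[symmetric])
qed

section \<open>Choice of parameters\<close>

definition int_disorder :: "real \<Rightarrow> nat" where
  "int_disorder D = nat \<lceil>D\<rceil>"

definition sample_rate :: "nat \<Rightarrow> nat" where
  "sample_rate n = Suc (nat \<lceil>12 * ln (real n)\<rceil>)"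

definition depth :: "nat \<Rightarrow> real \<Rightarrow> nat" where
  "depth n D = (LEAST H. 0 < H \<and> n \<le> sample_rate n * (17 * int_disorder D) ^ H)"

lemma int_disorder_bounds:
  assumes "1 \<le> D"
  shows "D \<le> real (int_disorder D)" "real (int_disorder D) \<le> 2 * D" "1 \<le> int_disorder D"
  using assms unfolding int_disorder_def by linarith+

lemma depth_reaches_n:
  assumes "1 \<le> D" "0 < n"
  shows "0 < depth n D" "n \<le> sample_rate n * (17 * int_disorder D) ^ depth n D"
proof -
  have "n \<le> 2 ^ n"
    by (simp add: less_imp_le)
  also have "\<dots> \<le> (17 * int_disorder D) ^ n"
    using int_disorder_bounds(3)[OF assms(1)] by (intro power_mono) auto
  also have "\<dots> \<le> sample_rate n * (17 * int_disorder D) ^ n"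
    by (simp add: sample_rate_def)
  finally have "0 < n \<and> n \<le> sample_rate n * (17 * int_disorder D) ^ n"
    using assms(2) by simp
  then have "0 < depth n D \<and> n \<le> sample_rate n * (17 * int_disorder D) ^ depth n D"
    unfolding depth_def by (rule LeastI)
  then show "0 < depth n D" "n \<le> sample_rate n * (17 * int_disorder D) ^ depth n D"
    by simp_all
qed

lemma less_below_depth:
  assumes "0 < j" "j < depth n D"
  shows "sample_rate n * (17 * int_disorder D) ^ j < n"
  using assms not_less_Least[of j "\<lambda>H. 0 < H \<and> n \<le> sample_rate n * (17 * int_disorder D) ^ H"]
  by (simp add: depth_def)

lemma depth_mult_ln_le:
  assumes "1 \<le> D" "0 < n"
  shows "(real (depth n D) - 1) * ln (17 * D) \<le> ln (real n)"
proof -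
  obtain h where h: "depth n D = Suc h"
    using depth_reaches_n(1)[OF assms] gr0_conv_Suc by blast
  have "(17 * int_disorder D) ^ h \<le> n"
  proof (cases "h = 0")
    case False
    have "(17 * int_disorder D) ^ h \<le> sample_rate n * (17 * int_disorder D) ^ h"
      by (simp add: sample_rate_def)
    also have "\<dots> < n"
      using False by (intro less_below_depth) (simp_all add: h)
    finally show ?thesis by simp
  qed (use assms(2) in simp)
  then have pow_le: "real ((17 * int_disorder D) ^ h) \<le> real n"
    by (simp only: of_nat_le_iff)
  have "(17 * D) ^ h \<le> (17 * real (int_disorder D)) ^ h"
    using assms(1) int_disorder_bounds(1)[OF assms(1)] by (intro power_mono) auto
  also have "\<dots> \<le> real n"
    using pow_le by simp
  finally have "(17 * D) ^ h \<le> real n" .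
  have "real h * ln (17 * D) = ln ((17 * D) ^ h)"
    by (rule ln_realpow[symmetric])
  also have "\<dots> \<le> ln (real n)"
    using assms \<open>(17 * D) ^ h \<le> real n\<close> by (intro ln_mono) auto
  finally show ?thesis
    by (simp add: h)
qed

lemma ln_gt_1:
  assumes "3 \<le> (x :: real)"
  shows "1 < ln x"
proof -
  have "exp 1 < x"
    using e_less_272 assms by linarith
  then show ?thesis
    using ln_less_cancel_iff[of "exp 1" x] assms by simp
qed

lemma depth_le:
  assumes "3 \<le> n" "1 \<le> D"
  shows "real (depth n D) \<le> 2 * ln (real n)"
proof -
  have "1 \<le> ln (17 * D)"
    using ln_gt_1[of "17 * D"] assms(2) by simp
  then have "(real (depth n D) - 1) * 1 \<le> (real (depth n D) - 1) * ln (17 * D)"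
    using depth_reaches_n(1)[OF assms(2), of n] assms(1) by (intro mult_left_mono) auto
  also have "\<dots> \<le> ln (real n)"
    using assms by (intro depth_mult_ln_le) auto
  finally show ?thesis
    using ln_gt_1[of "real n"] assms(1) by simp
qed

lemma depth_le_ln_quotient:
  assumes "3 \<le> n" "1 \<le> D" "D \<le> real n + 1"
  shows "real (depth n D) \<le> 4 * (ln (real n) / ln (2 * D))"
proof -
  have ln_2D: "0 < ln (2 * D)"
    using assms(2) by simp
  have "2 * (real n + 1) \<le> 3 * real n"
    using assms(1) by simp
  also have "\<dots> \<le> real n ^ 2 * real n"
    using assms(1) power_mono[of 3 "real n" 2] by (intro mult_right_mono) auto
  finally have "2 * D \<le> real n ^ 3"
    using assms(3) by (simp add: power2_eq_square power3_eq_cube)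
  then have "ln (2 * D) \<le> ln (real n ^ 3)"
    using assms by (intro ln_mono) auto
  also have "\<dots> = 3 * ln (real n)"
    using assms(1) by (simp add: ln_realpow)
  finally have "1 \<le> 3 * (ln (real n) / ln (2 * D))"
    using ln_2D by (simp add: le_divide_eq)
  moreover have "(real (depth n D) - 1) * ln (2 * D) \<le> (real (depth n D) - 1) * ln (17 * D)"
    using depth_reaches_n(1)[OF assms(2), of n] assms by (intro mult_left_mono ln_mono) auto
  then have "(real (depth n D) - 1) * ln (2 * D) \<le> ln (real n)"
    using depth_mult_ln_le[OF assms(2), of n] assms(1) by simp
  then have "real (depth n D) - 1 \<le> ln (real n) / ln (2 * D)"
    using ln_2D by (simp add: le_divide_eq)
  ultimately show ?thesis
    by simp
qed

lemma ceillog2_le_ln: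
  assumes "0 < m"
  shows "real (ceillog2 m) \<le> 2 * ln (real m) + 1"
proof -
  have "(1 / 2 :: real) \<le> ln 2"
    using ln_one_minus_pos_upper_bound[of "1 / 2"] by (simp add: ln_div)
  then have "log 2 (real m) \<le> 2 * ln (real m)"
    unfolding log_def using assms mult_left_mono[of "1 / 2" "ln 2" "2 * ln (real m)"]
    by (simp add: divide_le_eq mult_ac)
  then show ?thesis
    using ceillog2_less_log[OF assms] by simp
qed

lemma ceillog2_card_tables_le:
  assumes "3 \<le> n" "1 \<le> D" "D \<le> real n + 1"
  shows "real (ceillog2 (card (tables n (depth n D))))
    \<le> 24 * (real n * (ln (real n))\<^sup>2 / ln (2 * D))"
proof -
  let ?l = "ln (real n)" and ?H = "depth n D"
  have l: "1 < ?l"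
    using ln_gt_1 assms(1) by simp
  have "real n + 1 \<le> 3 * real n"
    using assms(1) by simp
  also have "\<dots> \<le> real n ^ 2"
    using assms(1) by (simp add: power2_eq_square)
  finally have "ln (real (Suc n)) \<le> ln (real n ^ 2)"
    by (intro ln_mono) auto
  then have ln_Suc: "ln (real (Suc n)) \<le> 2 * ?l"
    using assms(1) by (simp add: ln_realpow)
  have "real (ceillog2 (card (tables n ?H))) \<le> 2 * ln (real (Suc n ^ (n * ?H))) + 1"
    unfolding card_tables by (intro ceillog2_le_ln) simp
  also have "\<dots> = 2 * (real (n * ?H) * ln (real (Suc n))) + 1"
    by (simp add: ln_realpow del: of_nat_Suc)
  also have "\<dots> \<le> 2 * (real (n * ?H) * (2 * ?l)) + real (n * ?H) * (2 * ?l)"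
  proof (intro add_mono mult_left_mono ln_Suc)
    have "1 \<le> real (n * ?H)"
      using assms(1) depth_reaches_n(1)[OF assms(2), of n]
      by (simp add: Suc_le_eq flip: of_nat_mult)
    then show "1 \<le> real (n * ?H) * (2 * ?l)"
      using l mult_mono[of 1 "real (n * ?H)" 1 "2 * ?l"] by simp
  qed auto
  also have "\<dots> = 6 * real n * ?l * real ?H"
    by simp
  also have "\<dots> \<le> 6 * real n * ?l * (4 * (?l / ln (2 * D)))"
    using l depth_le_ln_quotient[OF assms] by (intro mult_left_mono) auto
  also have "\<dots> = 24 * (real n * ?l\<^sup>2 / ln (2 * D))"
    by (simp add: power2_eq_square)
  finally show ?thesis .
qed

lemma candidate_cap_le:
  assumes "3 \<le> n" "1 \<le> D"
  shows "real (candidate_cap (int_disorder D) (sample_rate n)) \<le> 68880 * (D ^ 3 * ln (real n))"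
proof -
  have "1 < ln (real n)"
    using ln_gt_1 assms(1) by simp
  then have "real (sample_rate n) \<le> 14 * ln (real n)"
    unfolding sample_rate_def by linarith
  moreover have "real (int_disorder D) ^ 3 \<le> (2 * D) ^ 3"
    using int_disorder_bounds(2)[OF assms(2)] by (intro power_mono) auto
  ultimately have "real (int_disorder D) ^ 3 * real (sample_rate n)
      \<le> (2 * D) ^ 3 * (14 * ln (real n))"
    using assms(2) by (intro mult_mono) auto
  then show ?thesis
    by (simp add: candidate_cap_def power_mult_distrib mult_ac)
qed

lemma ceillog2_le_mult_ln:
  fixes a t0 :: real
  assumes "1 < t0" "1 \<le> a"
  obtains Q where "0 \<le> Q"
    "\<And>m t. 0 < m \<Longrightarrow> t0 \<le> t \<Longrightarrow> real m \<le> a * t \<Longrightarrow> real (ceillog2 m) \<le> Q * ln t"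
proof
  let ?Q = "2 + (2 * ln a + 1) / ln t0"
  show "0 \<le> ?Q"
    using assms by simp
  fix m :: nat and t :: real
  assume m: "0 < m" "real m \<le> a * t" and "t0 \<le> t"
  have "ln (real m) \<le> ln (a * t)"
    using m by (intro ln_mono) auto
  then have "ln (real m) \<le> ln a + ln t"
    using assms \<open>t0 \<le> t\<close> by (simp add: ln_mult)
  then have "real (ceillog2 m) \<le> 2 * ln t + (2 * ln a + 1)"
    using ceillog2_le_ln[OF m(1)] by simp
  also have "\<dots> = 2 * ln t + (2 * ln a + 1) / ln t0 * ln t0"
    using assms(1) by simp
  also have "\<dots> \<le> 2 * ln t + (2 * ln a + 1) / ln t0 * ln t"
    using assms \<open>t0 \<le> t\<close> by (intro add_left_mono mult_left_mono) auto
  finally show "real (ceillog2 m) \<le> ?Q * ln t"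
    by (simp add: distrib_right)
qed

lemma depth_mult_level_cost_bound:
  fixes c :: real
  obtains C where "c \<le> C"
    "\<And>n D. 3 \<le> n \<Longrightarrow> 1 \<le> D \<Longrightarrow>
      real (depth n D * level_cost (int_disorder D) (sample_rate n))
        \<le> C * (D ^ 3 * (ln (real n))\<^sup>2 * ln (ln (real n powr (D ^ 3))))"
proof -
  obtain Q where Q: "0 \<le> Q"
    "\<And>m t. 0 < m \<Longrightarrow> ln 3 \<le> t \<Longrightarrow> real m \<le> 68880 * t \<Longrightarrow> real (ceillog2 m) \<le> Q * ln t"
    using ceillog2_le_mult_ln[of "ln 3" 68880] ln_gt_1[of 3] by auto
  have "real (depth n D * level_cost (int_disorder D) (sample_rate n))
      \<le> (137760 * Q + \<bar>c\<bar>) * (D ^ 3 * (ln (real n))\<^sup>2 * ln (ln (real n powr (D ^ 3))))"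
    if n: "3 \<le> n" and D: "1 \<le> D" for n D
  proof -
    let ?l = "ln (real n)" and ?cap = "candidate_cap (int_disorder D) (sample_rate n)"
    define t where "t = D ^ 3 * ?l"
    have l: "1 < ?l" "ln 3 \<le> ?l"
      using ln_gt_1 n by simp_all
    have "?l \<le> t"
      unfolding t_def using D l mult_right_mono[of 1 "D ^ 3" ?l] by simp
    then have t: "ln 3 \<le> t" "1 < t"
      using l by simp_all
    have cap_pos: "0 < ?cap"
      using int_disorder_bounds(3)[OF D] by (simp add: candidate_cap_def sample_rate_def)
    have cap: "real ?cap \<le> 68880 * t"
      unfolding t_def using n D by (rule candidate_cap_le)
    have "real (depth n D * level_cost (int_disorder D) (sample_rate n)) =
        real (depth n D) * (real (ceillog2 ?cap) * real ?cap)"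
      by (simp add: level_cost_def)
    also have "\<dots> \<le> (2 * ?l) * ((Q * ln t) * (68880 * t))"
      using depth_le[OF n D] Q(2)[OF cap_pos t(1) cap] cap Q(1) l t
      by (intro mult_mono mult_nonneg_nonneg) auto
    also have "\<dots> = 137760 * Q * (D ^ 3 * ?l\<^sup>2 * ln t)"
      by (simp add: t_def power2_eq_square)
    also have "\<dots> \<le> (137760 * Q + \<bar>c\<bar>) * (D ^ 3 * ?l\<^sup>2 * ln t)"
      using D t by (intro mult_right_mono) auto
    also have "ln t = ln (ln (real n powr (D ^ 3)))"
      using n by (simp add: t_def ln_powr)
    finally show ?thesis .
  qed
  then show ?thesis
    using Q(1) by (intro that[of "137760 * Q + \<bar>c\<bar>"]) auto
qed

definition nn_build :: "nat \<Rightarrow> real \<Rightarrow> (nat, bool list) dtree pmf" where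
  "nn_build n D = hierarchy_build n (int_disorder D) (sample_rate n) (depth n D)"

definition nn_search :: "nat \<Rightarrow> real \<Rightarrow> bool list \<Rightarrow> (ref, nat) dtree pmf" where
  "nn_search n D = hierarchy_search n (int_disorder D) (sample_rate n) (depth n D)"

definition nn_costs_within ::
  "real \<Rightarrow> nat \<Rightarrow> real \<Rightarrow> (nat \<Rightarrow> nat \<Rightarrow> nat \<Rightarrow> nat) \<Rightarrow> (ref \<Rightarrow> nat \<Rightarrow> nat \<Rightarrow> nat) \<Rightarrow> bool" where
  "nn_costs_within C n D orc orc' \<longleftrightarrow> (\<forall>b\<in>set_pmf (nn_build n D).
     set (asked orc b) \<subseteq> {..<n} \<times> {..<n} \<times> {..<n} \<and>
     real (length (asked orc b))
       \<le> C * (real n * D ^ 3 * (ln (real n))\<^sup>2 * ln (ln (real n powr (D ^ 3)))) \<and>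
     real (length (outcome orc b)) \<le> C * (real n * (ln (real n))\<^sup>2 / ln (2 * D)) \<and>
     (\<forall>s\<in>set_pmf (nn_search n D (outcome orc b)).
        set (asked orc' s) \<subseteq> insert Query (Stored ` {..<n}) \<times> {..<n} \<times> {..<n} \<and>
        real (length (asked orc' s))
          \<le> C * (D ^ 3 * (ln (real n))\<^sup>2 * ln (ln (real n powr (D ^ 3))))))"

lemma ex_nn_costs_within:
  "\<exists>C>0. \<forall>n D orc orc'. 3 \<le> n \<longrightarrow> 1 \<le> D \<longrightarrow> D \<le> real n + 1 \<longrightarrow> nn_costs_within C n D orc orc'"
proof -
  obtain C where C: "24 \<le> C" and questions: "\<And>n D. 3 \<le> n \<Longrightarrow> 1 \<le> D \<Longrightarrow>
      real (depth n D * level_cost (int_disorder D) (sample_rate n))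
        \<le> C * (D ^ 3 * (ln (real n))\<^sup>2 * ln (ln (real n powr (D ^ 3))))"
    by (rule depth_mult_level_cost_bound[of 24]) blast
  have "nn_costs_within C n D orc orc'"
    if n: "3 \<le> n" and D: "1 \<le> D" "D \<le> real n + 1" for n D orc orc'
    unfolding nn_costs_within_def
  proof (intro ballI conjI)
    let ?questions = "depth n D * level_cost (int_disorder D) (sample_rate n)"
    fix b assume b: "b \<in> set_pmf (nn_build n D)"
    note build = hierarchy_build_costs[OF _ b[unfolded nn_build_def], of orc]
    show "set (asked orc b) \<subseteq> {..<n} \<times> {..<n} \<times> {..<n}"
      using build(1) n by simp
    have "real (length (asked orc b)) \<le> real n * real ?questions"
      using build(2) n by (simp only: of_nat_le_iff flip: of_nat_mult)
    also have "\<dots> \<le> real n * (C * (D ^ 3 * (ln (real n))\<^sup>2 * ln (ln (real n powr (D ^ 3)))))"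
      using questions[OF n D(1)] by (rule mult_left_mono) simp
    finally show "real (length (asked orc b))
        \<le> C * (real n * D ^ 3 * (ln (real n))\<^sup>2 * ln (ln (real n powr (D ^ 3))))"
      by (simp only: mult_ac)
    have "real (length (outcome orc b)) \<le> 24 * (real n * (ln (real n))\<^sup>2 / ln (2 * D))"
      using build(3) ceillog2_card_tables_le[OF n D] n by simp
    also have "\<dots> \<le> C * (real n * (ln (real n))\<^sup>2 / ln (2 * D))"
      using C D(1) by (intro mult_right_mono) auto
    finally show "real (length (outcome orc b)) \<le> C * (real n * (ln (real n))\<^sup>2 / ln (2 * D))" .
    fix s assume s: "s \<in> set_pmf (nn_search n D (outcome orc b))"
    note search =
      hierarchy_search_costs[OF _ b[unfolded nn_build_def] s[unfolded nn_search_def], of orc']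
    show "set (asked orc' s) \<subseteq> insert Query (Stored ` {..<n}) \<times> {..<n} \<times> {..<n}"
      using search(1) n by simp
    have "real (length (asked orc' s)) \<le> real ?questions"
      using search(2) n by (simp only: of_nat_le_iff)
    then show "real (length (asked orc' s))
        \<le> C * (D ^ 3 * (ln (real n))\<^sup>2 * ln (ln (real n powr (D ^ 3))))"
      using questions[OF n D(1)] by (rule order_trans)
  qed
  then show ?thesis
    using C by (intro exI[of _ C]) auto
qed

lemma failure_probability_le:
  assumes "3 \<le> n" "1 \<le> D"
  shows "4 * (real (Suc n * depth n D) * exp (- real (sample_rate n) / 2)) \<le> 1 / real n"
proof -
  have n: "3 \<le> real n"
    using assms(1) by simp
  have "12 * ln (real n) \<le> real (sample_rate n)"
    unfolding sample_rate_def by linarith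
  then have "exp (- real (sample_rate n) / 2) \<le> exp (- (real 6 * ln (real n)))"
    by simp
  also have "\<dots> = 1 / real n ^ 6"
    using n unfolding exp_minus exp_of_nat_mult by (simp add: inverse_eq_divide)
  finally have exp_le: "exp (- real (sample_rate n) / 2) \<le> 1 / real n ^ 6" .
  have "real (depth n D) \<le> 2 * real n"
    using depth_le[OF assms] ln_bound[of "real n"] n by linarith
  then have "(real n + 1) * real (depth n D) \<le> (real n + 1) * (2 * real n)"
    by (intro mult_left_mono) auto
  then have "4 * real (Suc n * depth n D) \<le> 4 * ((real n + 1) * (2 * real n))"
    by (simp add: algebra_simps)
  also have "\<dots> \<le> 27 * real n * real n"
    using n by simp
  also have "\<dots> \<le> real n ^ 3 * real n * real n"
    using power_mono[OF n, of 3] by (intro mult_right_mono) auto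
  finally have "4 * real (Suc n * depth n D) \<le> real n ^ 5"
    by (simp add: eval_nat_numeral mult_ac)
  then have "4 * real (Suc n * depth n D) * exp (- real (sample_rate n) / 2)
      \<le> real n ^ 5 * (1 / real n ^ 6)"
    using exp_le by (intro mult_mono) auto
  also have "\<dots> = 1 / real n"
    using n by (simp add: field_simps eval_nat_numeral)
  finally show ?thesis
    by (simp only: mult.assoc)
qed

lemma rank_disorder_bounds:
  assumes "hidden_space K d" "T \<subseteq> K" "q \<in> K" "finite T" "2 \<le> card T"
  shows "1 \<le> rank_disorder d (T \<union> {q})" "rank_disorder d (T \<union> {q}) \<le> real (card T) + 1"
    and "disorder_inequalities d (T \<union> {q}) (rank_disorder d (T \<union> {q}))"
proof -
  interpret ranked_set d "T \<union> {q}"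
    using assms by (intro ranked_set_hidden_space[of K]) auto
  show "disorder_inequalities d (T \<union> {q}) (rank_disorder d (T \<union> {q}))"
    by (rule rank_disorder_least)
  moreover obtain x y where "x \<in> T" "y \<in> T" "x \<noteq> y"
    using assms(4,5) card_le_Suc0_iff_eq[of T] by force
  ultimately show "1 \<le> rank_disorder d (T \<union> {q})"
    using disorder_inequalities_ge_1 by blast
  have "card (T \<union> {q}) \<le> card T + 1"
    using card_Un_le[of T "{q}"] by simp
  then show "rank_disorder d (T \<union> {q}) \<le> real (card T) + 1"
    using rank_disorder_least(2) by linarith
qed

lemma search_instance_hidden_space:
  assumes "hidden_space K d" "T \<subseteq> K" "bij_betw obj {..<n} T" "q \<in> K" "3 \<le> n"
    and D: "1 \<le> D" "disorder_inequalities d (T \<union> {q}) D"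
  shows "search_instance d (T \<union> {q}) n (int_disorder D) (sample_rate n) (depth n D) obj q"
proof -
  have T: "T = obj ` {..<n}" and inj: "inj_on obj {..<n}"
    using assms(3) by (auto simp: bij_betw_def)
  interpret ranked_set d "T \<union> {q}"
    using assms(1,2,4) by (intro ranked_set_hidden_space[of K]) (auto simp: T)
  show ?thesis
  proof
    show "disorder_inequalities d (T \<union> {q}) (real (int_disorder D))"
      using D(2) int_disorder_bounds(1)[OF D(1)] by (rule disorder_inequalities_mono)
    show "1 \<le> int_disorder D"
      using int_disorder_bounds(3)[OF D(1)] .
    show "0 < depth n D" "n \<le> sample_rate n * (17 * int_disorder D) ^ depth n D"
      using depth_reaches_n[OF D(1)] assms(5) by simp_all
    show "sample_rate n * (17 * int_disorder D) ^ j < n" if "0 < j" "j < depth n D" for j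
      using that by (rule less_below_depth)
  qed (use assms(5) inj in \<open>auto simp: sample_rate_def T\<close>)
qed

lemma prob_nn_search_nearest:
  assumes "hidden_space K d" "T \<subseteq> K" "bij_betw obj {..<n} T" "q \<in> K" "3 \<le> n"
    and "1 \<le> D" "disorder_inequalities d (T \<union> {q}) D"
  shows "1 - 1 / real n \<le> measure_pmf.prob
    (nn_build n D \<bind> (\<lambda>b. map_pmf (outcome (search_oracle d obj q))
       (nn_search n D (outcome (build_oracle d obj) b))))
    {i. i < n \<and> nearest_neighbor d T q (obj i)}"
proof -
  interpret search_instance d "T \<union> {q}" n "int_disorder D" "sample_rate n" "depth n D" obj q
    using assms by (rule search_instance_hidden_space)
  have "obj ` {..<n} = T"
    using assms(3) by (simp add: bij_betw_def)
  then show ?thesis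
    using prob_nearest_neighbor_found failure_probability_le[OF assms(5,6)]
    by (simp add: nn_build_def nn_search_def)
qed

theorem theorem1:
  "\<exists>C>0. \<exists>(build :: nat \<Rightarrow> real \<Rightarrow> (nat, bool list) dtree pmf)
          (search :: nat \<Rightarrow> real \<Rightarrow> bool list \<Rightarrow> (ref, nat) dtree pmf).
     \<forall>(n::nat) (K :: 'a set) d T obj q D.
       n \<ge> 3 \<and> hidden_space K d \<and> T \<subseteq> K \<and> card T = n \<and> bij_betw obj {..<n} T \<and> q \<in> K \<and>
       D = rank_disorder d (T \<union> {q}) \<longrightarrow>
       (\<forall>b\<in>set_pmf (build n D).
          set (asked (build_oracle d obj) b) \<subseteq> {..<n} \<times> {..<n} \<times> {..<n} \<and>
          real (length (asked (build_oracle d obj) b))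
            \<le> C * (real n * D ^ 3 * (ln (real n))\<^sup>2 * ln (ln (real n powr (D ^ 3)))) \<and>
          real (length (outcome (build_oracle d obj) b))
            \<le> C * (real n * (ln (real n))\<^sup>2 / ln (2 * D)) \<and>
          (\<forall>s\<in>set_pmf (search n D (outcome (build_oracle d obj) b)).
             set (asked (search_oracle d obj q) s)
               \<subseteq> insert Query (Stored ` {..<n}) \<times> {..<n} \<times> {..<n} \<and>
             real (length (asked (search_oracle d obj q) s))
               \<le> C * (D ^ 3 * (ln (real n))\<^sup>2 * ln (ln (real n powr (D ^ 3)))))) \<and>
       measure_pmf.prob
         (build n D \<bind> (\<lambda>b.
            map_pmf (outcome (search_oracle d obj q))
              (search n D (outcome (build_oracle d obj) b))))
         {i. i < n \<and> nearest_neighbor d T q (obj i)} \<ge> 1 - 1 / real n"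
proof -
  obtain C where "0 < C"
    and costs: "\<And>n D orc orc'. 3 \<le> n \<Longrightarrow> 1 \<le> D \<Longrightarrow> D \<le> real n + 1 \<Longrightarrow>
      nn_costs_within C n D orc orc'"
    using ex_nn_costs_within by blast
  show ?thesis
  proof (intro exI[of _ C] exI[of _ nn_build] exI[of _ nn_search] conjI[OF \<open>0 < C\<close>] allI impI,
      goal_cases)
    case (1 n K d T obj q D)
    then have n: "3 \<le> n" and space: "hidden_space K d" "T \<subseteq> K" "bij_betw obj {..<n} T" "q \<in> K"
      and T: "finite T" "card T = n" and D: "D = rank_disorder d (T \<union> {q})"
      by (auto intro: card_ge_0_finite)
    have D_bounds: "1 \<le> D" "D \<le> real n + 1" "disorder_inequalities d (T \<union> {q}) D"
      using rank_disorder_bounds[OF space(1,2,4) T(1)] T(2) n unfolding D by simp_all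
    show ?case
      using costs[OF n D_bounds(1,2), unfolded nn_costs_within_def]
        prob_nn_search_nearest[OF space n D_bounds(1,3)]
      by blast
  qed
qed

end
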